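(* Let $p/q$ be an even rational parameter, $\omega=p+q$, and let $B=[0,\omega]^2$ be the first block. Then there exists a plaid polygon contained in $B$ whose $x$-diameter is at least $\omega^2/(2q)-1$. Moreover, this polygon is invariant under reflection in the horizontal midline $y=\omega/2$ of $B$.
   Context: An even rational parameter is a rational $p/q\in(0,1)$, $p,q$ positive coprime integers, $pq$ even. Put $\omega=p+q$, $P=2p/\omega$, $Q=2q/\omega$. Line families: $\mathcal H$ = lines $y=n$, $\mathcal V$ = lines $x=n$ ($n\in\mathbb Z$), $\mathcal P$ = lines of slope $-P$ with integer $y$-intercept, $\mathcal Q$ = lines of slope $-Q$ with integer $y$-intercept. Functions mod $2\mathbb Z$, values represented in $(-1,1]$: $F_H=2Py$, $F_V=2Px$, $F_P=Py+P^2x+1$, $F_Q=Py+PQx+1$. A unit segment is an edge of a unit square of the integer grid; horizontal ones lie on $\mathcal H$-lines (set $A=H$), vertical ones on $\mathcal V$-lines ($A=V$). A point $z$ of a unit segment $s$ is a light point of $s$ if for some $B'\in\{P,Q\}$, $z$ lies on a line of $\mathcal B'$, $F_A(z)F_{B'}(z)>0$ and $|F_{B'}(z)|<|F_A(z)|$. The light count of $s$ is the number of distinct light points of $s$, a light point that is the midpoint of a horizontal $s$ counted twice; $s$ is good if its light count is $1$. In each unit square draw the segments joining its center to the midpoints of its good edges; plaid polygons are the connected components of the union of all these segments. The $x$-diameter of a planar set is the diameter of its projection to the $x$-axis. *)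

theory Defs
  imports "HOL-Analysis.Analysis"
begin

definition even_rational_param :: "nat \<Rightarrow> nat \<Rightarrow> bool" where
  "even_rational_param p q \<longleftrightarrow> 0 < p \<and> p < q \<and> coprime p q \<and> even (p * q)"

text \<open>Representative of t modulo 2Z in the interval (-1,1].\<close>
definition rep2 :: "real \<Rightarrow> real" where
  "rep2 t = t - 2 * of_int \<lceil>(t - 1) / 2\<rceil>"

definition omg :: "nat \<Rightarrow> nat \<Rightarrow> real" where "omg p q = real (p + q)"
definition PP :: "nat \<Rightarrow> nat \<Rightarrow> real" where "PP p q = 2 * real p / omg p q"
definition QQ :: "nat \<Rightarrow> nat \<Rightarrow> real" where "QQ p q = 2 * real q / omg p q"

definition F_H :: "nat \<Rightarrow> nat \<Rightarrow> real \<times> real \<Rightarrow> real" where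
  "F_H p q z = rep2 (2 * PP p q * snd z)"
definition F_V :: "nat \<Rightarrow> nat \<Rightarrow> real \<times> real \<Rightarrow> real" where
  "F_V p q z = rep2 (2 * PP p q * fst z)"
definition F_P :: "nat \<Rightarrow> nat \<Rightarrow> real \<times> real \<Rightarrow> real" where
  "F_P p q z = rep2 (PP p q * snd z + (PP p q)\<^sup>2 * fst z + 1)"
definition F_Q :: "nat \<Rightarrow> nat \<Rightarrow> real \<times> real \<Rightarrow> real" where
  "F_Q p q z = rep2 (PP p q * snd z + PP p q * QQ p q * fst z + 1)"

definition on_P_line :: "nat \<Rightarrow> nat \<Rightarrow> real \<times> real \<Rightarrow> bool" where
  "on_P_line p q z \<longleftrightarrow> snd z + PP p q * fst z \<in> \<int>"
definition on_Q_line :: "nat \<Rightarrow> nat \<Rightarrow> real \<times> real \<Rightarrow> bool" where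
  "on_Q_line p q z \<longleftrightarrow> snd z + QQ p q * fst z \<in> \<int>"

datatype useg = Hseg int int | Vseg int int

fun seg_start :: "useg \<Rightarrow> real \<times> real" where
  "seg_start (Hseg i j) = (of_int i, of_int j)"
| "seg_start (Vseg i j) = (of_int i, of_int j)"

fun seg_end :: "useg \<Rightarrow> real \<times> real" where
  "seg_end (Hseg i j) = (of_int i + 1, of_int j)"
| "seg_end (Vseg i j) = (of_int i, of_int j + 1)"

definition seg_set :: "useg \<Rightarrow> (real \<times> real) set" where
  "seg_set s = closed_segment (seg_start s) (seg_end s)"

definition seg_mid :: "useg \<Rightarrow> real \<times> real" where
  "seg_mid s = midpoint (seg_start s) (seg_end s)"

fun is_horiz :: "useg \<Rightarrow> bool" where
  "is_horiz (Hseg i j) = True"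
| "is_horiz (Vseg i j) = False"

definition F_A :: "nat \<Rightarrow> nat \<Rightarrow> useg \<Rightarrow> real \<times> real \<Rightarrow> real" where
  "F_A p q s z = (if is_horiz s then F_H p q z else F_V p q z)"

definition light_point :: "nat \<Rightarrow> nat \<Rightarrow> useg \<Rightarrow> real \<times> real \<Rightarrow> bool" where
  "light_point p q s z \<longleftrightarrow> z \<in> seg_set s \<and>
     ((on_P_line p q z \<and> F_A p q s z * F_P p q z > 0 \<and> \<bar>F_P p q z\<bar> < \<bar>F_A p q s z\<bar>) \<or>
      (on_Q_line p q z \<and> F_A p q s z * F_Q p q z > 0 \<and> \<bar>F_Q p q z\<bar> < \<bar>F_A p q s z\<bar>))"

definition light_count :: "nat \<Rightarrow> nat \<Rightarrow> useg \<Rightarrow> nat" where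
  "light_count p q s = card {z. light_point p q s z}
     + (if is_horiz s \<and> light_point p q s (seg_mid s) then 1 else 0)"

definition good_seg :: "nat \<Rightarrow> nat \<Rightarrow> useg \<Rightarrow> bool" where
  "good_seg p q s \<longleftrightarrow> light_count p q s = 1"

definition sq_center :: "int \<Rightarrow> int \<Rightarrow> real \<times> real" where
  "sq_center i j = (of_int i + 1/2, of_int j + 1/2)"

definition sq_edges :: "int \<Rightarrow> int \<Rightarrow> useg set" where
  "sq_edges i j = {Hseg i j, Hseg i (j + 1), Vseg i j, Vseg (i + 1) j}"

definition plaid_union :: "nat \<Rightarrow> nat \<Rightarrow> (real \<times> real) set" where
  "plaid_union p q = \<Union> {closed_segment (sq_center i j) (seg_mid s) | i j s.
                          s \<in> sq_edges i j \<and> good_seg p q s}"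

definition plaid_polygons :: "nat \<Rightarrow> nat \<Rightarrow> (real \<times> real) set set" where
  "plaid_polygons p q = components (plaid_union p q)"

definition x_diameter :: "(real \<times> real) set \<Rightarrow> real" where
  "x_diameter C = diameter (fst ` C)"

end

theory Submission
  imports Defs
begin

text \<open>
  Everything is scaled by \<open>W = p + q\<close>. A slanted line carries an odd integer and a grid line an even
  one, both modulo \<open>2W\<close>, and the parity of "the line is light on the grid line" splits into a term
  of the slanted line, a term of the grid line, and a floor term. Every edge of a square in the first
  block meets exactly two slanted lines and every slanted line that meets the square crosses exactly
  two of its edges, so only the floor terms survive in the sum over the square, and they cancel in
  pairs. Hence each square has an even number of good edges, and every plaid polygon in the block
  crosses each grid line an even number of times.

  Choose \<open>m < W/2\<close> with \<open>2pm\<close> congruent to \<open>1\<close> or \<open>-1\<close> modulo \<open>W\<close>, so that the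
  lines \<open>y = m\<close> and \<open>x = m\<close> have capacity two. On \<open>y = m\<close> the light points are at \<open>x = 0\<close> and
  \<open>x = W\<^sup>2/(2q)\<close>; by parity, one polygon passes through both edges. This polygon must cross
  \<open>x = m\<close>, where there are at most two good edges, mirror images of each other; by parity it uses
  both, so it meets its mirror image.
\<close>

section \<open>Arithmetic of the odd modulus W\<close>

locale even_param =
  fixes p q :: nat
  assumes param: "even_rational_param p q"
begin

definition W :: int where "W = int p + int q"

lemma p_pos: "0 < p" and p_less_q: "p < q" and coprime_pq: "coprime p q"
  using param by (auto simp: even_rational_param_def)

lemma W_pos: "0 < W" and odd_W: "odd W"
proof -
  show "0 < W" using p_pos by (simp add: W_def)
  have "even (p * q)" using param by (auto simp: even_rational_param_def)
  moreover have "\<not> (even p \<and> even q)"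
    using coprime_pq coprime_common_divisor_nat[of p q 2] by auto
  ultimately show "odd W" by (auto simp: W_def)
qed

lemma coprime_p_W: "coprime (int p) W"
  using coprime_pq
  by (simp add: W_def coprime_iff_gcd_eq_1 gcd.commute)

lemma W_dvd_iff: "W dvd 2 * int p * k \<longleftrightarrow> W dvd k"
proof -
  have "coprime W (2 * int p)"
    using odd_W coprime_p_W by (simp add: coprime_commute)
  then show ?thesis by (simp add: coprime_dvd_mult_right_iff)
qed

lemma omg_eq: "omg p q = of_int W"
  by (simp add: omg_def W_def)

lemma PP_eq: "PP p q = 2 * of_nat p / of_int W" and QQ_eq: "QQ p q = 2 * of_nat q / of_int W"
  by (simp_all add: PP_def QQ_def omg_eq)

subsection \<open>Parity of light crossings\<close>

text \<open>The offset \<open>W - 1\<close> puts the remainder \<open>srep\<close> into the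
  half-open interval (-W, W], the scaled form of the interval of \<open>rep2\<close>.\<close>

definition wrap :: "int \<Rightarrow> int" where
  "wrap t = (t + W - 1) div (2 * W)"

definition srep :: "int \<Rightarrow> int" where
  "srep t = t - 2 * W * wrap t"

lemma srep_bounds: "- W < srep t" "srep t \<le> W"
proof -
  have "0 \<le> (t + W - 1) mod (2 * W)" "(t + W - 1) mod (2 * W) < 2 * W"
    using W_pos by auto
  moreover have "(t + W - 1) mod (2 * W) = srep t + W - 1"
    by (simp add: srep_def wrap_def minus_mult_div_eq_mod[symmetric])
  ultimately show "- W < srep t" "srep t \<le> W" by linarith+
qed

lemma srep_unique:
  assumes "- W < r" "r \<le> W" "2 * W dvd t - r"
  shows "srep t = r"
proof -
  obtain k where k: "t - r = 2 * W * k" using assms(3) by blast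
  have "t + W - 1 = (r + W - 1) + k * (2 * W)" using k by (simp add: algebra_simps)
  then have "wrap t = k + (r + W - 1) div (2 * W)"
    unfolding wrap_def using W_pos by (simp only: div_mult_self1)
  moreover have "(r + W - 1) div (2 * W) = 0"
    using assms(1,2) by (intro div_pos_pos_trivial) auto
  ultimately have "wrap t = k" by simp
  then show ?thesis using k by (simp add: srep_def)
qed

lemma rep2_of_int: "rep2 (of_int t / of_int W) = of_int (srep t) / of_int W"
proof -
  have b: "2 * W * (wrap t - 1) < t - W" "t - W \<le> 2 * W * wrap t"
    using srep_bounds[of t] by (simp_all add: srep_def algebra_simps)
  have b': "2 * of_int W * (of_int (wrap t) - 1) < (of_int t - of_int W :: real)"
    "(of_int t - of_int W :: real) \<le> 2 * of_int W * of_int (wrap t)"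
    using b by (metis (mono_tags) of_int_less_iff of_int_le_iff of_int_mult of_int_diff of_int_1 of_int_numeral)+
  have Wp: "(of_int W::real) > 0" using W_pos by linarith
  have "\<lceil>(of_int t / of_int W - 1) / 2 :: real\<rceil> = wrap t"
  proof (rule ceiling_unique)
    show "of_int (wrap t) - 1 < (of_int t / of_int W - 1 :: real) / 2"
      using b'(1) Wp by (simp add: field_simps)
    show "(of_int t / of_int W - 1 :: real) / 2 \<le> of_int (wrap t)"
      using b'(2) Wp by (simp add: field_simps)
  qed
  then show ?thesis
    using Wp by (simp add: rep2_def srep_def field_simps)
qed

text \<open>
  \<open>lit n m\<close>: a line of slope \<open>-P\<close> or \<open>-Q\<close> with intercept \<open>n\<close> is light on the grid line
  \<open>y = m\<close> or \<open>x = m\<close>. Both slopes share one predicate because \<open>F_P\<close> and \<open>F_Q\<close> both equal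
  \<open>Pn + 1\<close> along the line of intercept \<open>n\<close>.
\<close>
definition lit :: "int \<Rightarrow> int \<Rightarrow> bool" where
  "lit n m \<longleftrightarrow> (let f = srep (2 * int p * n + W); g = srep (4 * int p * m)
     in (0 < f \<and> f < g) \<or> (g < f \<and> f < 0))"

text \<open>The numerator is the unreduced value of the grid line minus that of the slanted line.
  Being affine in n and m, it obeys exact identities that are lost after reduction mod 2W.\<close>

definition quo :: "int \<Rightarrow> int \<Rightarrow> int" where
  "quo n m = (4 * int p * m - 2 * int p * n - W) div (2 * W)"

text \<open>Collects what depends on the slanted line alone, so that it cancels when the same line
  is counted on two edges.\<close>

definition line_par :: "int \<Rightarrow> int" where
  "line_par n = wrap (2 * int p * n + W) + of_bool (0 < srep (2 * int p * n + W))"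

lemma odd_srep: "odd (srep (2 * int p * n + W))"
  using odd_W by (simp add: srep_def)

lemma even_srep: "even (srep (4 * int p * m))"
  by (simp add: srep_def)

text \<open>Let f and g be the reduced values of the slanted line and the grid line. Since f is odd
  and g is even, f is neither 0 nor g, so lightness means that exactly one of 0 < f and g < f holds.
  The second condition is a floor: (g - f) div 2W is -1 if g < f and 0 otherwise. Undoing the
  reductions turns this floor into \<open>quo\<close>.\<close>

lemma lit_parity: "lit n m \<longleftrightarrow> odd (quo n m + line_par n + wrap (4 * int p * m))"
proof -
  define f where "f = srep (2 * int p * n + W)"
  define g where "g = srep (4 * int p * m)"
  have of: "odd f" "even g" unfolding f_def g_def by (rule odd_srep, rule even_srep)
  then have ne: "f \<noteq> 0" "f \<noteq> g" by auto
  have bd: "- W < f" "f \<le> W" "- W < g" "g \<le> W"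
    unfolding f_def g_def by (rule srep_bounds)+
  have "4 * int p * m - 2 * int p * n - W
      = (g - f) + (wrap (4 * int p * m) - wrap (2 * int p * n + W)) * (2 * W)"
    by (simp add: f_def g_def srep_def algebra_simps)
  then have "quo n m = (g - f) div (2 * W) + (wrap (4 * int p * m) - wrap (2 * int p * n + W))"
    unfolding quo_def using W_pos by (simp add: div_mult_self1)
  moreover have "(g - f) div (2 * W) = - of_bool (g < f)"
  proof (cases "g < f")
    case True
    have "(g - f) div (2 * W) = (g - f + 2 * W + (-1) * (2 * W)) div (2 * W)" by simp
    also have "\<dots> = -1 + (g - f + 2 * W) div (2 * W)"
      using W_pos by (subst div_mult_self1) auto
    also have "(g - f + 2 * W) div (2 * W) = 0"
      using bd True by (intro div_pos_pos_trivial) auto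
    finally have "(g - f) div (2 * W) = -1" by simp
    then show ?thesis using True by simp
  next
    case False
    then show ?thesis using bd by (auto intro!: div_pos_pos_trivial)
  qed
  ultimately have "odd (quo n m + line_par n + wrap (4 * int p * m)) \<longleftrightarrow>
      odd (of_bool (0 < f) + (of_bool (g < f) :: int))"
    by (simp add: line_par_def f_def[symmetric])
  also have "\<dots> \<longleftrightarrow> lit n m"
    unfolding lit_def Let_def f_def[symmetric] g_def[symmetric] using ne by auto
  finally show ?thesis by simp
qed

text \<open>The numerators satisfy u' = -u - 2W. As u is odd, 2W does not divide it, so negating u
  sends the floor k to -k - 1, and the two quotients add up to -2.\<close>

lemma quo_pair:
  assumes "n + n' = 2 * (m + m')"
  shows "even (quo n m + quo n' m')"
proof -
  define u where "u = 4 * int p * m - 2 * int p * n - W"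
  have n': "n' = 2 * (m + m') - n" using assms by simp
  have u': "4 * int p * m' - 2 * int p * n' - W = - u + (-1) * (2 * W)"
    by (simp add: u_def n' algebra_simps)
  have "odd u" using odd_W by (simp add: u_def)
  then have "\<not> 2 * W dvd u" by (meson dvd_mult_left)
  then have "(- u) div (2 * W) = - (u div (2 * W)) - 1"
    using W_pos by (simp add: zdiv_zminus1_eq_if dvd_eq_mod_eq_0)
  moreover have "quo n' m' = (- u) div (2 * W) + (-1)"
    unfolding quo_def u' using W_pos by (subst div_mult_self1) auto
  moreover have "quo n m = u div (2 * W)" by (simp add: quo_def u_def)
  ultimately show ?thesis by simp
qed

lemma quo_shift: "quo (n + 2) (m + 1) = quo n m"
  by (simp add: quo_def algebra_simps)

section \<open>Symmetries of lightness and the lines of capacity zero and two\<close>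

lemma srep_add: assumes "2 * W dvd t" shows "srep (s + t) = srep s"
proof (rule srep_unique)
  show "2 * W dvd s + t - srep s" using assms by (simp add: srep_def)
qed (rule srep_bounds)+

lemma srep_minus: "srep t \<noteq> W \<Longrightarrow> srep (- t) = - srep t"
  using srep_bounds[of t]
  by (intro srep_unique) (auto simp: srep_def)

lemma lit_add_W: "lit (n + k * W) m = lit n m" "lit n (m + k * W) = lit n m"
proof -
  have "srep (2 * int p * (n + k * W) + W) = srep (2 * int p * n + W)"
    using srep_add[of "2 * int p * (k * W)" "2 * int p * n + W"]
    by (simp add: algebra_simps)
  moreover have "srep (4 * int p * (m + k * W)) = srep (4 * int p * m)"
    using srep_add[of "4 * int p * (k * W)" "4 * int p * m"]
    by (simp add: algebra_simps)
  ultimately show "lit (n + k * W) m = lit n m" "lit n (m + k * W) = lit n m"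
    by (simp_all add: lit_def)
qed

lemma lit_uminus: "lit (- n) (- m) = lit n m"
proof -
  define f where "f = srep (2 * int p * n + W)"
  define g where "g = srep (4 * int p * m)"
  have "even g" unfolding g_def by (rule even_srep)
  then have gW: "g \<noteq> W" using odd_W by auto
  then have g': "srep (4 * int p * (- m)) = - g"
    using srep_minus[of "4 * int p * m"] by (simp add: g_def)
  have bd: "- W < g" "g \<le> W" unfolding g_def by (rule srep_bounds)+
  have f': "srep (2 * int p * (- n) + W) = srep (- (2 * int p * n + W))"
    using srep_add[of "2 * W" "- (2 * int p * n + W)"] by (simp add: algebra_simps)
  show ?thesis
  \<comment> \<open>The value W is its own negative mod 2W, so its representative does not change
    sign. It exceeds every |g|, hence neither side is lit.\<close>
  proof (cases "f = W")
    case True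
    then have "2 * int p * n = 2 * W * wrap (2 * int p * n + W)"
      by (simp add: f_def srep_def)
    then have "- (2 * int p * n + W) - W = 2 * W * (- wrap (2 * int p * n + W) - 1)"
      by (simp add: algebra_simps)
    then have "2 * W dvd - (2 * int p * n + W) - W" by (metis dvd_triv_left)
    then have "srep (- (2 * int p * n + W)) = W"
      by (intro srep_unique) (use W_pos in auto)
    then show ?thesis
      unfolding lit_def Let_def f' g' f_def[symmetric] g_def[symmetric] True
      using bd by auto
  next
    case False
    then have "srep (- (2 * int p * n + W)) = - f" unfolding f_def by (rule srep_minus)
    then show ?thesis
      unfolding lit_def Let_def f' g' f_def[symmetric] g_def[symmetric] by auto
  qed
qed

text \<open>With f, F, g the reduced values, f + F = g + 2We for some e in {-1, 0, 1}. For e = 0 the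
  map f -> g - f preserves lying strictly between 0 and g; otherwise neither line is lit. Since P +
  Q = 2, n -> 2m - n is also the effect of the reflection y -> -y on the intercept when a P-line
  through a point of x = m is traded for a Q-line.\<close>

lemma lit_flip:
  assumes "W dvd n + n' - 2 * m"
  shows "lit n m = lit n' m"
proof -
  obtain k where k: "n + n' - 2 * m = W * k" using assms by blast
  define f where "f = srep (2 * int p * n + W)"
  define g where "g = srep (4 * int p * m)"
  have of: "odd f" "even g" unfolding f_def g_def by (rule odd_srep, rule even_srep)
  have bd: "- W < f" "f \<le> W" "- W < g" "g \<le> W"
    unfolding f_def g_def by (rule srep_bounds)+
  define F where "F = srep (2 * int p * n' + W)"
  have bF: "- W < F" "F \<le> W" unfolding F_def by (rule srep_bounds)+
  have "f + F - g = 2 * W * (int p * k + 1 - wrap (2 * int p * n + W)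
     - wrap (2 * int p * n' + W) + wrap (4 * int p * m))"
  proof -
    have "n' = W * k - n + 2 * m" using k by simp
    then show ?thesis
      by (simp only: f_def F_def g_def srep_def) (simp add: algebra_simps)
  qed
  then obtain e where e: "f + F - g = 2 * W * e" by blast
  have e1: "e = -1 \<or> e = 0 \<or> e = 1"
  proof -
    have "W * e < W * 2" "W * (-2) < W * e" using e bd bF by linarith+
    then have "e < 2" "-2 < e" using W_pos by (simp_all only: mult_less_cancel_left_pos)
    then show ?thesis by linarith
  qed
  have "g \<noteq> W" using of odd_W by auto
  then have "(0 < f \<and> f < g) \<or> (g < f \<and> f < 0) \<longleftrightarrow> (0 < F \<and> F < g) \<or> (g < F \<and> F < 0)"
    using e1 e bd bF by auto
  then show ?thesis
    by (simp add: lit_def f_def F_def g_def Let_def)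
qed

lemma lit_0 [simp]: "\<not> lit n 0" "\<not> lit n W"
proof -
  have "srep 0 = 0" by (rule srep_unique) (use W_pos in auto)
  then show *: "\<not> lit n 0" for n by (auto simp: lit_def Let_def)
  show "\<not> lit n W" using *[of n] lit_add_W(2)[of n 0 1] by simp
qed

text \<open>If 2pm is 1 mod W, the grid line has reduced value 2, and a light line must have the odd
  value 1 between 0 and 2. Then 2pn and 2pm agree mod W, where 2p is invertible. The other sign
  follows by negating n and m.\<close>

lemma lit_capacity_two:
  assumes "W dvd 2 * int p * m - 1 \<or> W dvd 2 * int p * m + 1"
  shows "lit n m \<longleftrightarrow> W dvd n - m"
proof -
  have W3: "3 \<le> W" using p_pos p_less_q by (simp add: W_def)
  have pos: "lit n m \<longleftrightarrow> W dvd n - m" if "W dvd 2 * int p * m - 1" for n m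
  proof -
    from that obtain k where k: "2 * int p * m - 1 = W * k" by (rule dvdE)
    have "srep (4 * int p * m) = 2"
      by (rule srep_unique) (use W3 k in \<open>auto simp: algebra_simps intro!: dvdI[of _ _ k]\<close>)
    then have "lit n m \<longleftrightarrow> srep (2 * int p * n + W) = 1"
      unfolding lit_def Let_def by auto
    also have "\<dots> \<longleftrightarrow> 2 * W dvd 2 * int p * n + W - 1"
    proof
      assume "srep (2 * int p * n + W) = 1"
      then have "2 * int p * n + W - 1 = 2 * W * wrap (2 * int p * n + W)"
        by (simp add: srep_def)
      then show "2 * W dvd 2 * int p * n + W - 1" by simp
    qed (use W3 in \<open>auto intro: srep_unique\<close>)
    \<comment> \<open>The number is even in any case and W is odd, so divisibility by 2W reduces to
      divisibility by W.\<close>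
    also have "\<dots> \<longleftrightarrow> W dvd 2 * int p * n + W - 1"
    proof -
      have "coprime 2 W" using odd_W by simp
      moreover have "even (2 * int p * n + W - 1)" using odd_W by simp
      ultimately show ?thesis by (meson divides_mult dvd_mult_right)
    qed
    also have "\<dots> \<longleftrightarrow> W dvd 2 * int p * (n - m)"
    proof -
      have "2 * int p * n + W - 1 = 2 * int p * (n - m) + W * (1 + k)"
        using k by (simp add: algebra_simps)
      then show ?thesis by (simp add: dvd_add_left_iff)
    qed
    finally show ?thesis by (simp only: W_dvd_iff)
  qed
  from assms show ?thesis
  proof
    assume "W dvd 2 * int p * m + 1"
    then have "W dvd - (2 * int p * m + 1)" by (simp only: dvd_minus_iff)
    then have "W dvd 2 * int p * (- m) - 1" by simp
    from pos[OF this, of "- n"] have "lit n m \<longleftrightarrow> W dvd - (n - m)"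
      by (simp add: lit_uminus)
    then show ?thesis by (simp only: dvd_minus_iff)
  qed (rule pos)
qed

subsection \<open>Light points on unit segments\<close>

fun seg_index :: "useg \<Rightarrow> int" where
  "seg_index (Hseg i j) = j"
| "seg_index (Vseg i j) = i"

lemma seg_set_H: "(x, y) \<in> seg_set (Hseg i j) \<longleftrightarrow> y = of_int j \<and> of_int i \<le> x \<and> x \<le> of_int i + 1"
proof
  assume "(x, y) \<in> seg_set (Hseg i j)"
  then obtain u where "0 \<le> u" "u \<le> 1" "x = (1 - u) * of_int i + u * (of_int i + 1)"
    "y = (1 - u) * of_int j + u * of_int j"
    by (auto simp: seg_set_def in_segment)
  then show "y = of_int j \<and> of_int i \<le> x \<and> x \<le> of_int i + 1" by (auto simp: algebra_simps)
next
  assume a: "y = of_int j \<and> of_int i \<le> x \<and> x \<le> of_int i + 1"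
  show "(x, y) \<in> seg_set (Hseg i j)"
    unfolding seg_set_def in_segment
    by (rule exI[of _ "x - of_int i"]) (use a in \<open>auto simp: algebra_simps\<close>)
qed

lemma seg_set_V: "(x, y) \<in> seg_set (Vseg i j) \<longleftrightarrow> x = of_int i \<and> of_int j \<le> y \<and> y \<le> of_int j + 1"
proof
  assume "(x, y) \<in> seg_set (Vseg i j)"
  then obtain u where "0 \<le> u" "u \<le> 1" "y = (1 - u) * of_int j + u * (of_int j + 1)"
    "x = (1 - u) * of_int i + u * of_int i"
    by (auto simp: seg_set_def in_segment)
  then show "x = of_int i \<and> of_int j \<le> y \<and> y \<le> of_int j + 1" by (auto simp: algebra_simps)
next
  assume a: "x = of_int i \<and> of_int j \<le> y \<and> y \<le> of_int j + 1"
  show "(x, y) \<in> seg_set (Vseg i j)"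
    unfolding seg_set_def in_segment
    by (rule exI[of _ "y - of_int j"]) (use a in \<open>auto simp: algebra_simps\<close>)
qed

lemma seg_mid_H: "seg_mid (Hseg i j) = (of_int i + 1/2, of_int j)"
  and seg_mid_V: "seg_mid (Vseg i j) = (of_int i, of_int j + 1/2)"
  by (simp_all add: seg_mid_def midpoint_def field_simps)

lemma real_W_pos: "(0::real) < of_int W"
  using W_pos by linarith

lemma light_values:
  "(of_int (srep (4 * int p * m)) / of_int W * (of_int (srep (2 * int p * n + W)) / of_int W) > (0::real)
    \<and> \<bar>of_int (srep (2 * int p * n + W)) / of_int W\<bar> < \<bar>of_int (srep (4 * int p * m)) / (of_int W::real)\<bar>)
   \<longleftrightarrow> lit n m"
proof -
  have "(of_int g / of_int W * (of_int f / of_int W) > (0::real)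
      \<and> \<bar>of_int f / of_int W\<bar> < \<bar>of_int g / (of_int W::real)\<bar>)
     \<longleftrightarrow> (0 < f \<and> f < g) \<or> (g < f \<and> f < 0)" for f g :: int
    using real_W_pos
    by (auto simp: abs_if zero_less_mult_iff zero_less_divide_iff divide_less_0_iff divide_strict_right_mono
        field_simps not_less)
  then show ?thesis by (simp add: lit_def Let_def)
qed

lemma slanted_value:
  assumes "y + A * x = of_int n"
  shows "rep2 (PP p q * y + PP p q * A * x + 1) = of_int (srep (2 * int p * n + W)) / of_int W"
proof -
  have "PP p q * y + PP p q * A * x + 1 = PP p q * (y + A * x) + 1" by (simp add: algebra_simps)
  also have "\<dots> = of_int (2 * int p * n + W) / of_int W"
    unfolding assms PP_eq using real_W_pos by (simp add: field_simps)
  finally show ?thesis by (simp only: rep2_of_int)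
qed

lemma F_A_value:
  assumes "z \<in> seg_set s"
  shows "F_A p q s z = of_int (srep (4 * int p * seg_index s)) / of_int W"
proof -
  have *: "2 * PP p q * of_int m = of_int (4 * int p * m) / of_int W" for m
    by (simp add: PP_eq)
  show ?thesis
    using assms by (cases s; cases z)
      (auto simp: F_A_def F_H_def F_V_def seg_set_H seg_set_V * rep2_of_int simp del: of_int_mult)
qed

lemma light_point_iff:
  "light_point p q s z \<longleftrightarrow> z \<in> seg_set s \<and>
    (\<exists>n. (snd z + PP p q * fst z = of_int n \<or> snd z + QQ p q * fst z = of_int n) \<and> lit n (seg_index s))"
proof (cases "z \<in> seg_set s")
  case True
  have P: "F_A p q s z * F_P p q z > 0 \<and> \<bar>F_P p q z\<bar> < \<bar>F_A p q s z\<bar> \<longleftrightarrow> lit n (seg_index s)"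
    if "snd z + PP p q * fst z = of_int n" for n
    using slanted_value[OF that] light_values[of "seg_index s" n]
    by (simp only: F_P_def F_A_value[OF True] power2_eq_square)
  have Q: "F_A p q s z * F_Q p q z > 0 \<and> \<bar>F_Q p q z\<bar> < \<bar>F_A p q s z\<bar> \<longleftrightarrow> lit n (seg_index s)"
    if "snd z + QQ p q * fst z = of_int n" for n
    using slanted_value[OF that] light_values[of "seg_index s" n]
    by (simp only: F_Q_def F_A_value[OF True])
  show ?thesis
    unfolding light_point_def on_P_line_def on_Q_line_def Ints_def
    using True P Q by blast
qed (simp add: light_point_def)

text \<open>Reduces goodness to an exclusive or. In the first situation each light candidate
  contributes 1 to the count. In the second both candidates are the doubly counted midpoint, and the
  count is 0 or 2.\<close>

lemma good_seg_two_points: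
  assumes "{z. light_point p q s z} = (if a then {z1} else {}) \<union> (if b then {z2} else {})"
    and "(z1 \<noteq> z2 \<and> (is_horiz s \<longrightarrow> seg_mid s \<noteq> z1 \<and> seg_mid s \<noteq> z2)) \<or>
      (is_horiz s \<and> z1 = seg_mid s \<and> z2 = seg_mid s \<and> a = b)"
  shows "good_seg p q s \<longleftrightarrow> a \<noteq> b"
proof -
  have "light_point p q s (seg_mid s) \<longleftrightarrow> a \<and> seg_mid s = z1 \<or> b \<and> seg_mid s = z2"
  proof -
    have "seg_mid s \<in> {z. light_point p q s z} \<longleftrightarrow> a \<and> seg_mid s = z1 \<or> b \<and> seg_mid s = z2"
      unfolding assms(1) by auto
    then show ?thesis by simp
  qed
  then show ?thesis
    unfolding good_seg_def light_count_def assms(1) using assms(2) by auto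
qed

lemma P_line_iff: "y + PP p q * x = of_int n \<longleftrightarrow> 2 * of_nat p * x = of_int W * (of_int n - y)"
  and Q_line_iff: "y + QQ p q * x = of_int n \<longleftrightarrow> 2 * of_nat q * x = of_int W * (of_int n - y)"
  using real_W_pos by (auto simp: PP_eq QQ_eq field_simps)

lemma cut_interval:
  fixes a k i :: int
  assumes "0 < a" "of_int a * x = (of_int k :: real)"
  shows "of_int i \<le> x \<and> x \<le> of_int i + 1 \<longleftrightarrow> a * i \<le> k \<and> k \<le> a * (i + 1)"
proof -
  have a: "(0::real) < of_int a" using assms(1) by simp
  have "of_int i \<le> x \<longleftrightarrow> of_int a * of_int i \<le> of_int a * x"
    using a by (simp add: mult_le_cancel_left_pos)
  also have "\<dots> \<longleftrightarrow> a * i \<le> k" unfolding assms(2) by (metis of_int_le_iff of_int_mult)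
  finally have 1: "of_int i \<le> x \<longleftrightarrow> a * i \<le> k" .
  have "x \<le> of_int i + 1 \<longleftrightarrow> of_int a * x \<le> of_int a * of_int (i + 1)"
    using a by (simp add: mult_le_cancel_left_pos)
  also have "\<dots> \<longleftrightarrow> k \<le> a * (i + 1)" unfolding assms(2) by (metis of_int_le_iff of_int_mult)
  finally show ?thesis using 1 by simp
qed

text \<open>
  Abscissa at which the \<open>P\<close>-line (\<open>Q\<close>-line) of intercept \<open>j + k\<close> meets \<open>y = j\<close>.
\<close>
definition P_cut :: "int \<Rightarrow> real" where "P_cut k = of_int (W * k) / of_int (2 * int p)"
definition Q_cut :: "int \<Rightarrow> real" where "Q_cut k = of_int (W * k) / of_int (2 * int q)"

lemma light_point_H_iff:
  "light_point p q (Hseg i j) (x, y) \<longleftrightarrow> y = of_int j \<and>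
    ((\<exists>k. x = P_cut k \<and> 2 * int p * i \<le> W * k \<and> W * k \<le> 2 * int p * (i + 1) \<and> lit (j + k) j) \<or>
     (\<exists>k. x = Q_cut k \<and> 2 * int q * i \<le> W * k \<and> W * k \<le> 2 * int q * (i + 1) \<and> lit (j + k) j))"
proof -
  have pq: "0 < 2 * int p" "0 < 2 * int q" using p_pos p_less_q by auto
  have P: "of_int j + PP p q * x = of_int (j + k) \<longleftrightarrow> x = P_cut k" for k
    unfolding P_line_iff P_cut_def using p_pos by (auto simp: field_simps)
  have Q: "of_int j + QQ p q * x = of_int (j + k) \<longleftrightarrow> x = Q_cut k" for k
    unfolding Q_line_iff Q_cut_def using pq by (auto simp: field_simps)
  have shift: "(\<exists>n. R n) \<longleftrightarrow> (\<exists>k. R (j + k))" for R :: "int \<Rightarrow> bool"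
    by (metis add.commute diff_add_cancel)
  have iP: "of_int i \<le> x \<and> x \<le> of_int i + 1 \<longleftrightarrow> 2 * int p * i \<le> W * k \<and> W * k \<le> 2 * int p * (i + 1)"
    if "x = P_cut k" for k
    by (rule cut_interval[OF pq(1)]) (use that p_pos in \<open>simp add: P_cut_def\<close>)
  have iQ: "of_int i \<le> x \<and> x \<le> of_int i + 1 \<longleftrightarrow> 2 * int q * i \<le> W * k \<and> W * k \<le> 2 * int q * (i + 1)"
    if "x = Q_cut k" for k
    by (rule cut_interval[OF pq(2)]) (use that pq in \<open>simp add: Q_cut_def\<close>)
  show ?thesis
    unfolding light_point_iff seg_set_H fst_conv snd_conv seg_index.simps
    by (subst shift) (use P Q iP iQ in blast)
qed

section \<open>Good edges in terms of the slanted lines that cross them\<close>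

lemma W_dvd_small:
  assumes "W dvd i" "0 \<le> i" "i \<le> W" shows "i = 0 \<or> i = W"
proof (cases "i < W")
  case True
  then show ?thesis using zdvd_imp_le[OF assms(1)] assms(2) by fastforce
qed (use assms in auto)

lemma int_mult_le_lessD: "W * a \<le> b \<Longrightarrow> b < W * c \<Longrightarrow> a < c"
  and int_mult_less_leD: "W * a < b \<Longrightarrow> b \<le> W * c \<Longrightarrow> a < c"
  using W_pos by (metis mult_less_cancel_left_pos order_le_less_trans order_less_le_trans)+

text \<open>Here c is the ceiling of 2pi/W, and the last bound says that the P-cut of index c falls
  on the edge. P-cuts are W/(2p) > 1 apart, so it is the only one. As Q = 2 - P, one further Q-line
  crosses the edge.\<close>

lemma good_H_one_P_line:
  assumes i: "0 \<le> i" "i < W"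
    and c: "W * (c - 1) < 2 * int p * i" "2 * int p * i \<le> W * c" "W * c \<le> 2 * int p * (i + 1)"
  shows "good_seg p q (Hseg i j) \<longleftrightarrow> lit (j + c) j \<noteq> lit (j + 2 * i - c + 1) j"
proof (rule good_seg_two_points)
  have pW: "2 * int p < W" using p_less_q by (simp add: W_def)
  have qW: "2 * int q = 2 * W - 2 * int p" by (simp add: W_def)
  define k2 where "k2 = 2 * i - c + 1"
  \<comment> \<open>Since 2q = 2W - 2p, bounds on a Q-cut become bounds of 2pi and 2p(i + 1) by
    multiples of W, comparable with those on c.\<close>
  have Qi: "2 * int q * i \<le> W * k \<longleftrightarrow> W * (2 * i - k) \<le> 2 * int p * i"
    "W * k \<le> 2 * int q * (i + 1) \<longleftrightarrow> 2 * int p * (i + 1) \<le> W * (2 * i - k + 2)" for k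
    unfolding qW by (auto simp: algebra_simps)
  have Ponly: "k = c" if "2 * int p * i \<le> W * k" "W * k \<le> 2 * int p * (i + 1)" for k
  proof -
    have "c - 1 < k" using int_mult_less_leD[OF c(1) that(1)] .
    moreover have "W * k < W * (c + 1)" using that c pW by (simp add: algebra_simps)
    then have "k < c + 1" using W_pos by (simp add: mult_less_cancel_left_pos)
    ultimately show ?thesis by simp
  qed
  have Qonly: "Q_cut k = Q_cut k2 \<and> lit (j + k2) j \<or> Q_cut k = P_cut c \<and> lit (j + c) j"
    if k: "2 * int q * i \<le> W * k" "W * k \<le> 2 * int q * (i + 1)" "lit (j + k) j" for k
  proof -
    define l where "l = 2 * i - k"
    have l: "W * l \<le> 2 * int p * i" "2 * int p * (i + 1) \<le> W * (l + 2)"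
      using k Qi[of k] by (simp_all add: l_def)
    have "W * l \<le> W * c" using l c by linarith
    then have "l \<le> c" using W_pos by simp
    moreover have "W * (c - 2 + 2) \<le> W * (l + 2)" using l c by simp
    then have "c - 2 \<le> l" using W_pos by (simp add: mult_le_cancel_left_pos)
    ultimately consider "l = c" | "l = c - 1" | "l = c - 2" by linarith
    then show ?thesis
    \<comment> \<open>The extreme cases occur only at the corners \<open>x = 0\<close> and \<open>x = W\<close> of the block, where the
      \<open>Q\<close>-line meets the edge in the same point as the \<open>P\<close>-line.\<close>
    proof cases
      case 1
      then have e: "2 * int p * i = W * c" using l c by simp
      then have "W dvd 2 * int p * i" by simp
      then have "i = 0" using W_dvd_iff[of i] W_dvd_small[of i] i by auto
      then have "c = 0" using e W_pos by simp
      then have "k = 0" using 1 \<open>i = 0\<close> by (simp add: l_def)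
      then show ?thesis using k(3) \<open>c = 0\<close> by (simp add: Q_cut_def P_cut_def)
    next
      case 2
      then have "k = k2" by (simp add: l_def k2_def)
      then show ?thesis using k(3) by simp
    next
      case 3
      then have e: "2 * int p * (i + 1) = W * c" using l c by simp
      then have "W dvd 2 * int p * (i + 1)" by simp
      then have "i + 1 = W" using W_dvd_iff[of "i + 1"] W_dvd_small[of "i + 1"] i by auto
      then have cp: "c = 2 * int p" using e W_pos by (simp add: mult.commute)
      then have kq: "k = 2 * int q"
        using 3 \<open>i + 1 = W\<close> qW unfolding l_def by linarith
      have "lit (j + k) j = lit (j + c) j"
      proof (rule lit_flip)
        have "j + k + (j + c) - 2 * j = W * 2" by (simp add: cp kq W_def)
        then show "W dvd j + k + (j + c) - 2 * j" by (metis dvd_triv_left)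
      qed
      moreover have "Q_cut k = P_cut c"
        using p_pos p_less_q by (simp add: Q_cut_def P_cut_def cp kq)
      ultimately show ?thesis using k(3) by simp
    qed
  qed
  have k2_in: "2 * int q * i \<le> W * k2" "W * k2 \<le> 2 * int q * (i + 1)"
    unfolding Qi k2_def using c pW W_pos by (simp_all add: algebra_simps)
  show "{z. light_point p q (Hseg i j) z} = (if lit (j + c) j then {(P_cut c, of_int j)} else {}) \<union>
     (if lit (j + 2 * i - c + 1) j then {(Q_cut k2, of_int j)} else {})"
  proof -
    have "j + 2 * i - c + 1 = j + k2" by (simp add: k2_def)
    have "light_point p q (Hseg i j) (x, y) \<longleftrightarrow>
        y = of_int j \<and> (lit (j + c) j \<and> x = P_cut c \<or> lit (j + k2) j \<and> x = Q_cut k2)" (is "?l \<longleftrightarrow> ?r") for x y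
    proof
      assume ?l
      then have y: "y = of_int j" unfolding light_point_H_iff by blast
      from \<open>?l\<close> consider k where "x = P_cut k" "2 * int p * i \<le> W * k"
          "W * k \<le> 2 * int p * (i + 1)" "lit (j + k) j"
        | k where "x = Q_cut k" "2 * int q * i \<le> W * k"
          "W * k \<le> 2 * int q * (i + 1)" "lit (j + k) j"
        unfolding light_point_H_iff by blast
      then show ?r
      proof cases
        case (1 k)
        then show ?r using Ponly[of k] y by simp
      next
        case (2 k)
        then show ?r using Qonly[of k] y by blast
      qed
    next
      assume ?r
      then show ?l unfolding light_point_H_iff using k2_in c(2,3) by (elim conjE disjE) blast+
    qed
    then show ?thesis unfolding \<open>j + 2 * i - c + 1 = j + k2\<close> by auto
  qed
  have pq: "(0::real) < of_nat p" "(0::real) < of_nat q" using p_pos p_less_q by auto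
  \<comment> \<open>The three possible coincidences (P-cut at the midpoint, Q-cut at the midpoint,
    P-cut equal to Q-cut) are one and the same equation.\<close>
  have mP: "P_cut c = of_int i + 1 / 2 \<longleftrightarrow> W * c = int p * (2 * i + 1)"
  proof -
    have "P_cut c = of_int i + 1 / 2 \<longleftrightarrow> of_int (W * c) = (of_int (int p * (2 * i + 1)) :: real)"
      using pq by (simp add: P_cut_def field_simps)
    then show ?thesis by (simp only: of_int_eq_iff)
  qed
  have mQ: "Q_cut k2 = of_int i + 1 / 2 \<longleftrightarrow> W * c = int p * (2 * i + 1)"
  proof -
    have "Q_cut k2 = of_int i + 1 / 2 \<longleftrightarrow> of_int (W * k2) = (of_int (int q * (2 * i + 1)) :: real)"
      using pq by (simp add: Q_cut_def field_simps)
    also have "\<dots> \<longleftrightarrow> W * k2 = int q * (2 * i + 1)" by (simp only: of_int_eq_iff)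
    also have "\<dots> \<longleftrightarrow> W * c = int p * (2 * i + 1)"
    proof -
      have "W * k2 - int q * (2 * i + 1) = int p * (2 * i + 1) - W * c"
        by (simp add: k2_def W_def algebra_simps)
      then show ?thesis by linarith
    qed
    finally show ?thesis .
  qed
  have PQ: "P_cut c = Q_cut k2 \<longleftrightarrow> W * c = int p * (2 * i + 1)"
  proof -
    have "P_cut c = Q_cut k2 \<longleftrightarrow> of_int c * real q = of_int k2 * real p"
      using pq real_W_pos by (simp add: Q_cut_def P_cut_def frac_eq_eq)
    also have "\<dots> \<longleftrightarrow> of_int (c * int q) = (of_int (k2 * int p) :: real)" by simp
    also have "\<dots> \<longleftrightarrow> c * int q = k2 * int p" by (simp only: of_int_eq_iff)
    also have "\<dots> \<longleftrightarrow> W * c = int p * (2 * i + 1)"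
    proof -
      have "c * int q - k2 * int p = W * c - int p * (2 * i + 1)"
        by (simp add: k2_def W_def algebra_simps)
      then show ?thesis by linarith
    qed
    finally show ?thesis .
  qed
  show "(P_cut c, real_of_int j) \<noteq> (Q_cut k2, real_of_int j) \<and>
    (is_horiz (Hseg i j) \<longrightarrow> seg_mid (Hseg i j) \<noteq> (P_cut c, real_of_int j) \<and>
      seg_mid (Hseg i j) \<noteq> (Q_cut k2, real_of_int j)) \<or>
    is_horiz (Hseg i j) \<and> (P_cut c, real_of_int j) = seg_mid (Hseg i j) \<and>
    (Q_cut k2, real_of_int j) = seg_mid (Hseg i j) \<and> lit (j + c) j = lit (j + 2 * i - c + 1) j"
  proof (cases "W * c = int p * (2 * i + 1)")
    \<comment> \<open>Both lines pass through the midpoint, whose double count makes the light count 0 or 2.\<close>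
    case True
    then have "W dvd int p * (2 * i + 1)" by (metis dvd_triv_left)
    then have "W dvd 2 * i + 1"
      using coprime_p_W by (simp add: coprime_commute coprime_dvd_mult_right_iff)
    then have "lit (j + c) j = lit (j + 2 * i - c + 1) j"
      by (intro lit_flip) (simp add: algebra_simps)
    then show ?thesis using True mP mQ by (auto simp: seg_mid_H)
  next
    case False
    then show ?thesis using mP mQ PQ by (auto simp: seg_mid_H)
  qed
qed

text \<open>Along the edge Px stays strictly between c - 1 and c, so Qx = 2x - Px passes exactly the
  integers 2i - c + 1 and 2i - c + 2.\<close>

lemma good_H_no_P_line:
  assumes c: "W * (c - 1) < 2 * int p * i" "2 * int p * (i + 1) < W * c"
  shows "good_seg p q (Hseg i j) \<longleftrightarrow> lit (j + 2 * i - c + 1) j \<noteq> lit (j + 2 * i - c + 2) j"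
proof (rule good_seg_two_points)
  have pW: "2 * int p < W" using p_less_q by (simp add: W_def)
  have qW: "2 * int q = 2 * W - 2 * int p" by (simp add: W_def)
  define k1 where "k1 = 2 * i - c + 1"
  define k2 where "k2 = 2 * i - c + 2"
  have Qi: "2 * int q * i \<le> W * k \<longleftrightarrow> W * (2 * i - k) \<le> 2 * int p * i"
    "W * k \<le> 2 * int q * (i + 1) \<longleftrightarrow> 2 * int p * (i + 1) \<le> W * (2 * i - k + 2)" for k
    unfolding qW by (auto simp: algebra_simps)
  have Pno: False if "2 * int p * i \<le> W * k" "W * k \<le> 2 * int p * (i + 1)" for k
    using int_mult_less_leD[OF c(1) that(1)] int_mult_le_lessD[OF that(2) c(2)] by simp
  have pi: "2 * int p * i \<le> 2 * int p * (i + 1)" by (simp add: algebra_simps)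
  have Qonly: "k = k1 \<or> k = k2"
    if k: "2 * int q * i \<le> W * k" "W * k \<le> 2 * int q * (i + 1)" for k
  proof -
    have "2 * i - k < c"
      by (rule int_mult_le_lessD[of _ "2 * int p * i"]) (use k Qi[of k] c pi in linarith)+
    moreover have "c - 1 < 2 * i - k + 2"
      by (rule int_mult_less_leD[of _ "2 * int p * i"]) (use k Qi[of k] c pi in linarith)+
    ultimately show ?thesis unfolding k1_def k2_def by linarith
  qed
  have k_in: "2 * int q * i \<le> W * k1" "W * k1 \<le> 2 * int q * (i + 1)"
    "2 * int q * i \<le> W * k2" "W * k2 \<le> 2 * int q * (i + 1)"
    unfolding Qi k1_def k2_def using c pW W_pos by (simp_all add: algebra_simps)
  show "{z. light_point p q (Hseg i j) z} =
     (if lit (j + 2 * i - c + 1) j then {(Q_cut k1, of_int j)} else {}) \<union>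
     (if lit (j + 2 * i - c + 2) j then {(Q_cut k2, of_int j)} else {})"
  proof -
    have "j + 2 * i - c + 1 = j + k1" "j + 2 * i - c + 2 = j + k2" by (simp_all add: k1_def k2_def)
    have "light_point p q (Hseg i j) (x, y) \<longleftrightarrow> y = of_int j \<and>
        (lit (j + k1) j \<and> x = Q_cut k1 \<or> lit (j + k2) j \<and> x = Q_cut k2)" (is "?l \<longleftrightarrow> ?r") for x y
    proof
      assume ?l
      then obtain k where "y = of_int j" "x = Q_cut k" "lit (j + k) j"
        and "2 * int q * i \<le> W * k" "W * k \<le> 2 * int q * (i + 1)"
        unfolding light_point_H_iff using Pno by blast
      then show ?r using Qonly[of k] by auto
    next
      assume ?r
      then show ?l unfolding light_point_H_iff using k_in by (elim conjE disjE) blast+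
    qed
    then show ?thesis
      unfolding \<open>j + 2 * i - c + 1 = j + k1\<close> \<open>j + 2 * i - c + 2 = j + k2\<close> by auto
  qed
  have pq: "(0::real) < of_nat p" "(0::real) < of_nat q" using p_pos p_less_q by auto
  have mQ: "Q_cut k = of_int i + 1 / 2 \<longleftrightarrow> W * (2 * i + 1 - k) = int p * (2 * i + 1)" for k
  proof -
    have "Q_cut k = of_int i + 1 / 2 \<longleftrightarrow> of_int (W * k) = (of_int (int q * (2 * i + 1)) :: real)"
      using pq by (simp add: Q_cut_def field_simps)
    also have "\<dots> \<longleftrightarrow> W * k = int q * (2 * i + 1)" by (simp only: of_int_eq_iff)
    also have "\<dots> \<longleftrightarrow> W * (2 * i + 1 - k) = int p * (2 * i + 1)"
    proof -
      have "W * k - int q * (2 * i + 1) = int p * (2 * i + 1) - W * (2 * i + 1 - k)"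
        by (simp add: W_def algebra_simps)
      then show ?thesis by linarith
    qed
    finally show ?thesis .
  qed
  \<comment> \<open>A Q-cut at the midpoint would make p(2i + 1) equal to Wc or W(c - 1), but it
    lies strictly between them.\<close>
  have "int p * (2 * i + 1) < W * c" "W * (c - 1) < int p * (2 * i + 1)"
    using c p_pos by (simp_all add: algebra_simps)
  then have "Q_cut k1 \<noteq> of_int i + 1 / 2" "Q_cut k2 \<noteq> of_int i + 1 / 2"
    unfolding mQ by (simp_all add: k1_def k2_def)
  moreover have "Q_cut k1 \<noteq> Q_cut k2"
    using pq real_W_pos by (simp add: Q_cut_def k1_def k2_def)
  ultimately show "(Q_cut k1, real_of_int j) \<noteq> (Q_cut k2, real_of_int j) \<and>
    (is_horiz (Hseg i j) \<longrightarrow> seg_mid (Hseg i j) \<noteq> (Q_cut k1, real_of_int j) \<and>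
      seg_mid (Hseg i j) \<noteq> (Q_cut k2, real_of_int j)) \<or>
    is_horiz (Hseg i j) \<and> (Q_cut k1, real_of_int j) = seg_mid (Hseg i j) \<and>
    (Q_cut k2, real_of_int j) = seg_mid (Hseg i j) \<and>
    lit (j + 2 * i - c + 1) j = lit (j + 2 * i - c + 2) j"
    by (auto simp: seg_mid_H)
qed

lemma not_good_if_never_lit:
  assumes "\<And>n. \<not> lit n (seg_index s)" shows "\<not> good_seg p q s"
  using assms by (simp add: good_seg_def light_count_def light_point_iff)

text \<open>With r = Pi, the P-lines meet x = i at heights congruent to -r mod 1 and the Q-lines at
  heights congruent to r, so each edge gets one of each when r is not an integer. On x = 0 and x = W
  nothing is light. The lower bound on c is weak because the right edge of a square takes its c from
  the left edge.\<close>

lemma good_V: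
  assumes i: "0 \<le> i" "i \<le> W" and c: "W * (c - 1) \<le> 2 * int p * i" "2 * int p * i \<le> W * c"
  shows "good_seg p q (Vseg i j) \<longleftrightarrow> lit (j + c) i \<noteq> lit (j + 2 * i - c + 1) i"
proof (cases "i = 0 \<or> i = W")
  case True
  then show ?thesis using not_good_if_never_lit[of "Vseg i j"] by auto
next
  case False
  then have "\<not> W dvd i" using W_dvd_small i by blast
  then have nd: "\<not> W dvd 2 * int p * i" by (simp add: W_dvd_iff)
  define r where "r = PP p q * of_int i"
  have r_W: "of_int (2 * int p * i) = of_int W * r"
    using real_W_pos by (simp add: r_def PP_eq)
  have le: "W * a \<le> 2 * int p * i \<longleftrightarrow> of_int a \<le> r" for a
  proof -
    have "W * a \<le> 2 * int p * i \<longleftrightarrow> of_int (W * a) \<le> (of_int (2 * int p * i) :: real)"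
      by (simp only: of_int_le_iff)
    also have "\<dots> \<longleftrightarrow> of_int a \<le> r" unfolding r_W using real_W_pos by simp
    finally show ?thesis .
  qed
  have ge: "2 * int p * i \<le> W * a \<longleftrightarrow> r \<le> of_int a" for a
  proof -
    have "2 * int p * i \<le> W * a \<longleftrightarrow> (of_int (2 * int p * i) :: real) \<le> of_int (W * a)"
      by (simp only: of_int_le_iff)
    also have "\<dots> \<longleftrightarrow> r \<le> of_int a" unfolding r_W using real_W_pos by simp
    finally show ?thesis .
  qed
  have ne: "r \<noteq> of_int a" for a
  proof
    assume "r = of_int a"
    then have "2 * int p * i = W * a" using le[of a] ge[of a] by simp
    then show False using nd by simp
  qed
  have cr: "of_int c - 1 < r" "r < of_int c"
    using c le[of "c - 1"] ge[of c] ne[of "c - 1"] ne[of c] by auto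
  have rQ: "QQ p q * of_int i = 2 * of_int i - r"
    using real_W_pos by (simp add: r_def PP_eq QQ_eq field_simps W_def)
  show ?thesis
  proof (rule good_seg_two_points)
    have "light_point p q (Vseg i j) (x, y) \<longleftrightarrow> x = of_int i \<and>
        (lit (j + c) i \<and> y = of_int (j + c) - r \<or>
         lit (j + 2 * i - c + 1) i \<and> y = of_int (j + 1 - c) + r)" (is "?l \<longleftrightarrow> ?r") for x y
    proof
      assume ?l
      then obtain n where x: "x = of_int i" and y: "of_int j \<le> y" "y \<le> of_int j + 1"
        and n: "y + r = of_int n \<or> y + 2 * of_int i - r = of_int n" and l: "lit n i"
        unfolding light_point_iff seg_set_V
        by (simp only: fst_conv snd_conv seg_index.simps) (metis r_def rQ add_diff_eq)
      from n show ?r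
      proof
        assume e: "y + r = of_int n"
        have "n = j + c" using e y cr by linarith
        then show ?r using x e l by auto
      next
        assume e: "y + 2 * of_int i - r = of_int n"
        have "n = j + 2 * i - c + 1" using e y cr by linarith
        then show ?r using x e l by auto
      qed
    next
      assume r: ?r
      then have x: "x = of_int i" by simp
      from r consider "lit (j + c) i" "y = of_int (j + c) - r"
        | "lit (j + 2 * i - c + 1) i" "y = of_int (j + 1 - c) + r" by blast
      then show ?l
      proof cases
        case 1
        then show ?l unfolding light_point_iff seg_set_V using x cr
          by (auto simp: r_def[symmetric] intro!: exI[of _ "j + c"])
      next
        case 2
        then show ?l unfolding light_point_iff seg_set_V using x cr
          by (auto simp: rQ intro!: exI[of _ "j + 2 * i - c + 1"])
      qed
    qed
    then show "{z. light_point p q (Vseg i j) z} =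
      (if lit (j + c) i then {(of_int i, of_int (j + c) - r)} else {}) \<union>
      (if lit (j + 2 * i - c + 1) i then {(of_int i, of_int (j + 1 - c) + r)} else {})"
      by auto
    \<comment> \<open>The two points are symmetric about the midpoint of the edge, so they coincide
      only if 2r is an odd integer, which makes a product of odd numbers even.\<close>
    have "of_int (j + c) - r \<noteq> of_int (j + 1 - c) + r"
    proof
      assume "of_int (j + c) - r = of_int (j + 1 - c) + r"
      then have "2 * r = of_int (2 * c - 1)" by simp
      have "of_int (2 * (2 * int p * i)) = 2 * (of_int W * r)" by (simp only: of_int_mult of_int_numeral flip: r_W)
      also have "\<dots> = of_int W * of_int (2 * c - 1)"
        unfolding \<open>2 * r = of_int (2 * c - 1)\<close>[symmetric] by simp
      finally have "of_int (2 * (2 * int p * i)) = (of_int (W * (2 * c - 1)) :: real)"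
        by (simp only: of_int_mult)
      then have "2 * (2 * int p * i) = W * (2 * c - 1)" by (simp only: of_int_eq_iff)
      then have "even (W * (2 * c - 1))" by (metis dvd_triv_left)
      then show False using odd_W by simp
    qed
    then show "(real_of_int i, of_int (j + c) - r) \<noteq> (of_int i, of_int (j + 1 - c) + r) \<and>
      (is_horiz (Vseg i j) \<longrightarrow> seg_mid (Vseg i j) \<noteq> (real_of_int i, of_int (j + c) - r) \<and>
        seg_mid (Vseg i j) \<noteq> (of_int i, of_int (j + 1 - c) + r)) \<or>
      is_horiz (Vseg i j) \<and> (real_of_int i, of_int (j + c) - r) = seg_mid (Vseg i j) \<and>
      (of_int i, of_int (j + 1 - c) + r) = seg_mid (Vseg i j) \<and>
      lit (j + c) i = lit (j + 2 * i - c + 1) i"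
      by simp
  qed
qed

subsection \<open>Parity of good edges\<close>

lemma ceiling_exists: obtains c where "W * (c - 1) < t" "t \<le> W * c"
proof
  let ?c = "- ((- t) div W)"
  have "0 \<le> (- t) mod W" "(- t) mod W < W" using W_pos by auto
  moreover have "(- t) mod W = - t + W * ?c" by (simp add: minus_mult_div_eq_mod[symmetric])
  ultimately show "W * (?c - 1) < t" "t \<le> W * ?c"
    by (simp_all add: right_diff_distrib del: mult_minus_right) (linarith+)?
qed

text \<open>Both lines are tested on the same grid line, so its term cancels.\<close>

lemma lit_neq: "(lit n m \<noteq> lit n' m) \<longleftrightarrow> odd (quo n m + quo n' m + line_par n + line_par n')"
  by (auto simp: lit_parity)

lemma even_of_bool_odd:
  "even (of_bool (odd a) + of_bool (odd b) + of_bool (odd c) + (of_bool (odd d) :: int))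
    \<longleftrightarrow> even (a + b + c + (d :: int))"
  by auto

lemma even_square:
  assumes i: "0 \<le> i" "i < W"
  shows "even (of_bool (good_seg p q (Hseg i j)) + of_bool (good_seg p q (Hseg i (j + 1))) +
    of_bool (good_seg p q (Vseg i j)) + (of_bool (good_seg p q (Vseg (i + 1) j)) :: int))"
proof -
  obtain c where c: "W * (c - 1) < 2 * int p * i" "2 * int p * i \<le> W * c"
    by (rule ceiling_exists)
  have pW: "2 * int p < W" using p_less_q by (simp add: W_def)
  define N where "N = j + c"
  define M where "M = j + 2 * i - c + 1"
  have NM: "N + M = 2 * i + 2 * j + 1" by (simp add: N_def M_def)
  have i1: "0 \<le> i + 1" "i + 1 \<le> W" using i by auto
  have L: "good_seg p q (Vseg i j) \<longleftrightarrow> lit N i \<noteq> lit M i"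
    unfolding N_def M_def by (rule good_V) (use i c in auto)
  show ?thesis
  proof (cases "W * c \<le> 2 * int p * (i + 1)")
    case True
    have B: "good_seg p q (Hseg i j) \<longleftrightarrow> lit N j \<noteq> lit M j"
      unfolding N_def M_def by (rule good_H_one_P_line) (use i c True in auto)
    have T: "good_seg p q (Hseg i (j + 1)) \<longleftrightarrow> lit (N + 1) (j + 1) \<noteq> lit (M + 1) (j + 1)"
      using good_H_one_P_line[OF i c True, of "j + 1"] by (simp add: N_def M_def algebra_simps)
    have R: "good_seg p q (Vseg (i + 1) j) \<longleftrightarrow> lit (N + 1) (i + 1) \<noteq> lit (M + 1) (i + 1)"
      using good_V[OF i1, of "c + 1" j] True c pW by (simp add: N_def M_def algebra_simps)
    \<comment> \<open>The P-line N and the Q-line M cross the left and bottom edges; N + 1 and M + 1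
      cross the top and right ones. Each floor term at the left or bottom is paired with one at the
      top or right, using N + M + 1 = 2(i + j + 1).\<close>
    have "even (quo N j + quo (M + 1) (i + 1))" "even (quo N i + quo (M + 1) (j + 1))"
      "even (quo (N + 1) (j + 1) + quo M i)" "even (quo (N + 1) (i + 1) + quo M j)"
      by (rule quo_pair, use NM in simp)+
    then have "even ((quo N j + quo (M + 1) (i + 1)) + (quo N i + quo (M + 1) (j + 1))
      + (quo (N + 1) (j + 1) + quo M i) + (quo (N + 1) (i + 1) + quo M j)
      + 2 * (line_par N + line_par M + line_par (N + 1) + line_par (M + 1)))"
      by (rule dvd_add[OF dvd_add[OF dvd_add[OF dvd_add]]]) simp
    then show ?thesis
      unfolding B T L R lit_neq even_of_bool_odd by (simp only: mult_2 ac_simps)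
  next
    case False
    then have c2: "2 * int p * (i + 1) < W * c" by simp
    have B: "good_seg p q (Hseg i j) \<longleftrightarrow> lit M j \<noteq> lit (M + 1) j"
      using good_H_no_P_line[OF c(1) c2, of j] by (simp add: N_def M_def algebra_simps)
    have T: "good_seg p q (Hseg i (j + 1)) \<longleftrightarrow> lit (M + 1) (j + 1) \<noteq> lit (M + 2) (j + 1)"
      using good_H_no_P_line[OF c(1) c2, of "j + 1"] by (simp add: N_def M_def algebra_simps)
    have R: "good_seg p q (Vseg (i + 1) j) \<longleftrightarrow> lit N (i + 1) \<noteq> lit (M + 2) (i + 1)"
      using good_V[OF i1, of "c" j] c2 c pW by (simp add: N_def M_def algebra_simps)
    \<comment> \<open>The P-line N joins the left and right edges, while the Q-lines M, M + 1, M + 2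
      join left to bottom, bottom to top and top to right. The terms of M and M + 2 agree in pairs
      by \<open>quo_shift\<close>; those of N and M + 1 cancel by \<open>quo_pair\<close>.\<close>
    have "even (quo N i + quo (M + 1) (j + 1))" "even (quo N (i + 1) + quo (M + 1) j)"
      by (rule quo_pair, use NM in simp)+
    then have "even ((quo N i + quo (M + 1) (j + 1)) + (quo N (i + 1) + quo (M + 1) j)
      + 2 * (quo M j + quo M i + line_par N + line_par M + line_par (M + 1) + line_par (M + 2)))"
      by (rule dvd_add[OF dvd_add]) simp
    then show ?thesis
      unfolding B T L R lit_neq even_of_bool_odd quo_shift by (simp only: mult_2 ac_simps)
  qed
qed

subsection \<open>Reflection and components\<close>

definition refl_pt :: "real \<times> real \<Rightarrow> real \<times> real" where
  "refl_pt z = (fst z, of_int W - snd z)"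

fun refl_seg :: "useg \<Rightarrow> useg" where
  "refl_seg (Hseg i j) = Hseg i (W - j)"
| "refl_seg (Vseg i j) = Vseg i (W - 1 - j)"

lemma refl_pt_refl_pt [simp]: "refl_pt (refl_pt z) = z"
  and refl_seg_refl_seg [simp]: "refl_seg (refl_seg s) = s"
  and is_horiz_refl_seg [simp]: "is_horiz (refl_seg s) = is_horiz s"
  by (simp add: refl_pt_def, (cases s; simp)+)

lemma seg_mid_refl_seg: "seg_mid (refl_seg s) = refl_pt (seg_mid s)"
  by (cases s) (simp_all add: seg_mid_H seg_mid_V refl_pt_def)

text \<open>On horizontal edges reflection flips the sign of the slope, which \<open>lit_flip\<close> undoes; on vertical
  edges it exchanges the \<open>P\<close>-lines and the \<open>Q\<close>-lines.\<close>
lemma light_point_refl: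
  assumes "light_point p q s z" shows "light_point p q (refl_seg s) (refl_pt z)"
proof (cases s)
  case (Hseg i j)
  from assms obtain n where z: "z \<in> seg_set (Hseg i j)" and l: "lit n j"
    and n: "snd z + PP p q * fst z = of_int n \<or> snd z + QQ p q * fst z = of_int n"
    unfolding light_point_iff Hseg by auto
  have y: "snd z = of_int j" using z by (cases z) (simp add: seg_set_H)
  have "lit (n + W - 2 * j) (W - j) = lit (- (2 * j - n)) (- j)"
    using lit_add_W(1)[of "n - 2 * j" 1] lit_add_W(2)[of "n - 2 * j" "- j" 1]
    by (simp add: algebra_simps)
  also have "\<dots> = lit n j" unfolding lit_uminus by (rule lit_flip) simp
  finally have "lit (n + W - 2 * j) (W - j)" using l by simp
  then show ?thesis
    using z n y unfolding light_point_iff Hseg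
    by (cases z) (auto simp: seg_set_H refl_pt_def algebra_simps intro!: exI[of _ "n + W - 2 * j"])
next
  case (Vseg i j)
  from assms obtain n where z: "z \<in> seg_set (Vseg i j)" and l: "lit n i"
    and n: "snd z + PP p q * fst z = of_int n \<or> snd z + QQ p q * fst z = of_int n"
    unfolding light_point_iff Vseg by auto
  have x: "fst z = of_int i" using z by (cases z) (simp add: seg_set_V)
  have "lit (2 * i - n + W) i = lit (2 * i - n) i"
    using lit_add_W(1)[of "2 * i - n" 1 i] by simp
  also have "\<dots> = lit n i" by (rule lit_flip) simp
  finally have l': "lit (2 * i - n + W) i" using l by simp
  have QP: "QQ p q * of_int i = 2 * of_int i - PP p q * of_int i"
    using real_W_pos by (simp add: PP_eq QQ_eq field_simps W_def)
  show ?thesis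
    using z n x l' unfolding light_point_iff Vseg
    by (cases z) (auto simp: seg_set_V refl_pt_def QP intro!: exI[of _ "2 * i - n + W"])
qed

lemma good_seg_refl [simp]: "good_seg p q (refl_seg s) \<longleftrightarrow> good_seg p q s"
proof -
  have iff: "light_point p q (refl_seg s) z \<longleftrightarrow> light_point p q s (refl_pt z)" for z
    using light_point_refl[of s "refl_pt z"] light_point_refl[of "refl_seg s" z] by auto
  have "{z. light_point p q (refl_seg s) z} = refl_pt ` {z. light_point p q s z}"
    unfolding iff by (auto intro!: image_eqI[of _ refl_pt "refl_pt _"])
  moreover have "inj_on refl_pt A" for A by (metis inj_onI refl_pt_refl_pt)
  ultimately show ?thesis
    by (simp add: good_seg_def light_count_def iff seg_mid_refl_seg card_image)
qed

lemma refl_closed_segment: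
  "refl_pt ` closed_segment a b \<subseteq> closed_segment (refl_pt a) (refl_pt b)"
proof -
  have "refl_pt ((1 - u) *\<^sub>R a + u *\<^sub>R b) = (1 - u) *\<^sub>R refl_pt a + u *\<^sub>R refl_pt b" for u
    by (simp add: refl_pt_def prod_eq_iff algebra_simps)
  then show ?thesis by (fastforce simp: in_segment)
qed

abbreviation U :: "(real \<times> real) set" where "U \<equiv> plaid_union p q"

lemma half_segment_subset:
  assumes "s \<in> sq_edges i j" "good_seg p q s"
  shows "closed_segment (sq_center i j) (seg_mid s) \<subseteq> U"
  unfolding plaid_union_def using assms by blast

lemma refl_plaid_union: "refl_pt ` U \<subseteq> U"
proof -
  have "refl_pt ` closed_segment (sq_center i j) (seg_mid s) \<subseteq> U"
    if s: "s \<in> sq_edges i j" "good_seg p q s" for i j s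
  proof -
    have "refl_seg s \<in> sq_edges i (W - 1 - j)" using s by (auto simp: sq_edges_def)
    moreover have "refl_pt (sq_center i j) = sq_center i (W - 1 - j)"
      by (simp add: refl_pt_def sq_center_def)
    ultimately show ?thesis
      using half_segment_subset[of "refl_seg s" i "W - 1 - j"] s
        refl_closed_segment[of "sq_center i j" "seg_mid s"]
      by (simp add: seg_mid_refl_seg)
  qed
  then show ?thesis unfolding plaid_union_def[of p q] by (auto simp: image_subset_iff)
qed

text \<open>The mirror image of C is a connected subset of the plaid union that meets C, so
  maximality puts it inside C; the involution gives the converse.\<close>

lemma refl_component:
  assumes C: "C \<in> components U" and meet: "z \<in> C" "refl_pt z \<in> C"
  shows "refl_pt ` C = C"
proof -
  have "continuous_on C refl_pt"
    unfolding refl_pt_def by (intro continuous_intros)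
  then have "connected (refl_pt ` C)"
    using in_components_connected[OF C] by (rule connected_continuous_image)
  moreover have "refl_pt ` C \<subseteq> U"
    using refl_plaid_union in_components_subset[OF C] by blast
  ultimately have sub: "refl_pt ` C \<subseteq> C"
    using meet by (intro components_maximal[OF C]) auto
  moreover have "C \<subseteq> refl_pt ` C"
    using sub by (metis image_subset_iff refl_pt_refl_pt image_eqI subsetI)
  ultimately show ?thesis by blast
qed

section \<open>Crossings of a component with the grid lines\<close>

lemma plaid_union_on_vertical:
  assumes "(of_int a, y) \<in> U"
  obtains j where "good_seg p q (Vseg a j)" "(of_int a, y) = seg_mid (Vseg a j)"
proof -
  from assms obtain i j s where s: "s \<in> sq_edges i j" "good_seg p q s"
    and "(of_int a, y) \<in> closed_segment (sq_center i j) (seg_mid s)"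
    unfolding plaid_union_def by blast
  then obtain u where u: "0 \<le> u" "u \<le> 1"
    and eq: "(of_int a, y) = (1 - u) *\<^sub>R sq_center i j + u *\<^sub>R seg_mid s"
    by (auto simp: in_segment)
  \<comment> \<open>Half-segments to horizontal edges stay on the line x = i + 1/2. Those to
    vertical edges reach an integer abscissa only at their end u = 1.\<close>
  have half: "real_of_int a \<noteq> of_int i + 1/2"
  proof
    assume "real_of_int a = of_int i + 1/2"
    then have "2 * a = 2 * i + 1" by linarith
    then show False by presburger
  qed
  from s(1) consider j' where "s = Hseg i j'" | "s = Vseg i j" | "s = Vseg (i + 1) j"
    unfolding sq_edges_def by blast
  then show thesis
  proof cases
    case (1 j')
    then have "real_of_int a = (1 - u) * (of_int i + 1/2) + u * (of_int i + 1/2)"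
      using eq by (simp add: sq_center_def seg_mid_H)
    also have "\<dots> = of_int i + 1/2" by argo
    finally show thesis using half by simp
  next
    case 2
    then have x: "real_of_int a = of_int i + 1/2 - u / 2"
      using eq by (simp add: sq_center_def seg_mid_V field_simps)
    then have "a = i" using u half by linarith
    then have "u = 1" using x by simp
    then show thesis using that[of j] s eq 2 \<open>a = i\<close> by simp
  next
    case 3
    then have x: "real_of_int a = of_int i + 1/2 + u / 2"
      using eq by (simp add: sq_center_def seg_mid_V field_simps)
    then have "a = i + 1" using u half by linarith
    then have "u = 1" using x by simp
    then show thesis using that[of j] s eq 3 \<open>a = i + 1\<close> by simp
  qed
qed

lemma plaid_union_on_horizontal:
  assumes "(x, of_int b) \<in> U"
  obtains i where "good_seg p q (Hseg i b)" "(x, of_int b) = seg_mid (Hseg i b)"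
proof -
  from assms obtain i j s where s: "s \<in> sq_edges i j" "good_seg p q s"
    and "(x, of_int b) \<in> closed_segment (sq_center i j) (seg_mid s)"
    unfolding plaid_union_def by blast
  then obtain u where u: "0 \<le> u" "u \<le> 1"
    and eq: "(x, of_int b) = (1 - u) *\<^sub>R sq_center i j + u *\<^sub>R seg_mid s"
    by (auto simp: in_segment)
  have half: "real_of_int b \<noteq> of_int j + 1/2"
  proof
    assume "real_of_int b = of_int j + 1/2"
    then have "2 * b = 2 * j + 1" by linarith
    then show False by presburger
  qed
  from s(1) consider i' where "s = Vseg i' j" | "s = Hseg i j" | "s = Hseg i (j + 1)"
    unfolding sq_edges_def by blast
  then show thesis
  proof cases
    case (1 i')
    then have "real_of_int b = (1 - u) * (of_int j + 1/2) + u * (of_int j + 1/2)"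
      using eq by (simp add: sq_center_def seg_mid_V)
    also have "\<dots> = of_int j + 1/2" by argo
    finally show thesis using half by simp
  next
    case 2
    then have y: "real_of_int b = of_int j + 1/2 - u / 2"
      using eq by (simp add: sq_center_def seg_mid_H field_simps)
    then have "b = j" using u half by linarith
    then have "u = 1" using y by simp
    then show thesis using that[of i] s eq 2 \<open>b = j\<close> by simp
  next
    case 3
    then have y: "real_of_int b = of_int j + 1/2 + u / 2"
      using eq by (simp add: sq_center_def seg_mid_H field_simps)
    then have "b = j + 1" using u half by linarith
    then have "u = 1" using y by simp
    then show thesis using that[of i] s eq 3 \<open>b = j + 1\<close> by simp
  qed
qed

lemma not_good_boundary [simp]:
  "\<not> good_seg p q (Hseg i 0)" "\<not> good_seg p q (Hseg i W)"
  "\<not> good_seg p q (Vseg 0 j)" "\<not> good_seg p q (Vseg W j)"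
  by (rule not_good_if_never_lit, simp)+

definition crossing :: "(real \<times> real) set \<Rightarrow> useg \<Rightarrow> int" where
  "crossing C s = of_bool (good_seg p q s \<and> seg_mid s \<in> C)"

text \<open>Half-segments are connected, so C passes through all or none of the good edges of a
  square.\<close>

lemma even_crossing_square:
  assumes C: "C \<in> components U" and i: "0 \<le> i" "i < W"
  shows "even (crossing C (Hseg i j) + crossing C (Hseg i (j + 1)) +
    crossing C (Vseg i j) + crossing C (Vseg (i + 1) j))"
proof -
  have "seg_mid s \<in> C \<longleftrightarrow> sq_center i j \<in> C" if s: "s \<in> sq_edges i j" "good_seg p q s" for s
  proof -
    have "closed_segment (sq_center i j) (seg_mid s) \<subseteq> C"
      if "z \<in> C" "z \<in> closed_segment (sq_center i j) (seg_mid s)" for z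
      using that half_segment_subset[OF s] by (intro components_maximal[OF C]) auto
    then show ?thesis by (meson ends_in_segment subsetD)
  qed
  then have "crossing C s = (if sq_center i j \<in> C then of_bool (good_seg p q s) else 0)"
    if "s \<in> sq_edges i j" for s
    using that by (auto simp: crossing_def)
  then show ?thesis using even_square[OF i, of j] by (simp add: sq_edges_def)
qed

text \<open>Induction upwards from y = 0, where no edge is good. Summing the square parities along a
  strip, interior vertical edges cancel mod 2 and the outer ones, on x = 0 and x = W, are never
  good.\<close>

lemma even_crossings_row:
  assumes C: "C \<in> components U"
  shows "even (\<Sum>i<p + q. crossing C (Hseg (int i) (int k)))"
proof (induction k)
  case 0
  then show ?case by (simp add: crossing_def)
next
  case (Suc k)
  have "even ((\<Sum>i<n. crossing C (Hseg (int i) (int k)) + crossing C (Hseg (int i) (int k + 1)))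
      + crossing C (Vseg (int n) (int k)))" if "n \<le> p + q" for n
    using that
  proof (induction n)
    case 0
    then show ?case by (simp add: crossing_def)
  next
    case (Suc n)
    have "even (crossing C (Hseg (int n) (int k)) + crossing C (Hseg (int n) (int k + 1)) +
        crossing C (Vseg (int n) (int k)) + crossing C (Vseg (int n + 1) (int k)))"
      by (rule even_crossing_square[OF C]) (use Suc.prems in \<open>auto simp: W_def\<close>)
    with Suc show ?case by (auto simp: add.commute)
  qed
  from this[OF order_refl] Suc show ?case
    by (simp add: sum.distrib crossing_def W_def[symmetric] add.commute)
qed

lemma even_crossings_column:
  assumes C: "C \<in> components U" and "k \<le> p + q"
  shows "even (\<Sum>j<p + q. crossing C (Vseg (int k) (int j)))"
  using assms(2)
proof (induction k)
  case 0
  then show ?case by (simp add: crossing_def)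
next
  case (Suc k)
  have "even ((\<Sum>j<n. crossing C (Vseg (int k) (int j)) + crossing C (Vseg (int k + 1) (int j)))
      + crossing C (Hseg (int k) (int n)))" for n
  proof (induction n)
    case 0
    then show ?case by (simp add: crossing_def)
  next
    case (Suc n)
    have "even (crossing C (Hseg (int k) (int n)) + crossing C (Hseg (int k) (int n + 1)) +
        crossing C (Vseg (int k) (int n)) + crossing C (Vseg (int k + 1) (int n)))"
      by (rule even_crossing_square[OF C]) (use \<open>Suc k \<le> p + q\<close> in \<open>auto simp: W_def\<close>)
    with Suc show ?case by (auto simp: add.commute)
  qed
  from this[of "p + q"] Suc show ?case
    by (simp add: sum.distrib crossing_def W_def[symmetric] add.commute)
qed

text \<open>The plaid union meets grid lines only in midpoints of good edges, and the four lines
  bounding the block have none. Hence both projections of C are connected sets avoiding 0 and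
  W.\<close>

lemma component_in_block:
  assumes C: "C \<in> components U" and z: "(x0, y0) \<in> C" "0 \<le> x0" "x0 \<le> W" "0 \<le> y0" "y0 \<le> W"
  shows "C \<subseteq> {0..of_int W} \<times> {0..of_int W}"
proof -
  have con: "connected (fst ` C)" "connected (snd ` C)"
    using in_components_connected[OF C]
    by (auto intro!: connected_continuous_image continuous_intros)
  have avoid: "of_int a \<notin> fst ` C" "of_int a \<notin> snd ` C" if a: "a = 0 \<or> a = W" for a
  proof -
    have "(of_int a, y) \<notin> C" for y
    proof
      assume "(of_int a, y) \<in> C"
      then have "(of_int a, y) \<in> U" using in_components_subset[OF C] by blast
      then show False by (rule plaid_union_on_vertical) (use a in auto)
    qed
    then show "of_int a \<notin> fst ` C" by (auto simp: image_iff)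
    have "(x, of_int a) \<notin> C" for x
    proof
      assume "(x, of_int a) \<in> C"
      then have "(x, of_int a) \<in> U" using in_components_subset[OF C] by blast
      then show False by (rule plaid_union_on_horizontal) (use a in auto)
    qed
    then show "of_int a \<notin> snd ` C" by (auto simp: image_iff)
  qed
  have "S \<subseteq> {0..of_int W}"
    if S: "connected S" "of_int 0 \<notin> S" "of_int W \<notin> S" and t0: "t0 \<in> S" "0 \<le> t0" "t0 \<le> of_int W"
    for S :: "real set" and t0
  proof
    fix t assume t: "t \<in> S"
    have "\<not> t \<le> 0" "\<not> of_int W \<le> t"
      using connectedD_interval[OF S(1) t t0(1), of 0] connectedD_interval[OF S(1) t0(1) t, of "of_int W"]
        S t0 by auto
    then show "t \<in> {0..of_int W}" by simp
  qed
  from this[OF con(1) avoid(1) avoid(1), of x0] this[OF con(2) avoid(2) avoid(2), of y0]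
  have "fst ` C \<subseteq> {0..of_int W}" "snd ` C \<subseteq> {0..of_int W}"
    using z image_eqI[of x0 fst "(x0, y0)" C] image_eqI[of y0 snd "(x0, y0)" C] by simp_all
  then show ?thesis by (intro subsetI mem_Times_iff[THEN iffD2] conjI) blast+
qed

subsection \<open>Lines of capacity two\<close>

text \<open>Take the inverse r of 2p mod W, or W - r, whichever is below W/2.\<close>

lemma capacity_two_exists:
  obtains m where "1 \<le> m" "2 * m < W" "W dvd 2 * int p * m - 1 \<or> W dvd 2 * int p * m + 1"
proof -
  have W3: "3 \<le> W" using p_pos p_less_q by (simp add: W_def)
  have "gcd (2 * int p) W = 1"
    using odd_W coprime_p_W by (simp add: coprime_iff_gcd_eq_1[symmetric])
  then obtain u v where uv: "u * (2 * int p) + v * W = 1" by (metis bezout_int)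
  define r where "r = u mod W"
  have r: "0 \<le> r" "r < W" using W_pos by (simp_all add: r_def)
  have r_eq: "r = u - W * (u div W)" by (simp add: r_def minus_mult_div_eq_mod)
  have "2 * int p * r - 1 = W * (- v - 2 * int p * (u div W))"
    using uv unfolding r_eq by (simp add: algebra_simps)
  then have d: "W dvd 2 * int p * r - 1" by simp
  have "r \<noteq> 0"
  proof
    assume "r = 0"
    then show False using d W3 zdvd_imp_le[of W 1] by simp
  qed
  show thesis
  proof (cases "2 * r < W")
    case True
    then show thesis using that[of r] r \<open>r \<noteq> 0\<close> d by simp
  next
    case False
    have "2 * int p * (W - r) + 1 = W * (2 * int p) - (2 * int p * r - 1)" by (simp add: algebra_simps)
    then have "W dvd 2 * int p * (W - r) + 1" using d by (simp only: dvd_diff dvd_triv_left)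
    moreover have "2 * r \<noteq> W" using odd_W by (metis dvd_triv_left)
    ultimately show thesis using that[of "W - r"] r False by simp
  qed
qed

context
  fixes m :: int
  assumes m: "1 \<le> m" "2 * m < W"
    and cap: "W dvd 2 * int p * m - 1 \<or> W dvd 2 * int p * m + 1"
begin

text \<open>Column of the edge of y = m hit by the Q-line of intercept m + W, whose abscissa there
  is W^2/(2q).\<close>

definition far_col :: int where "far_col = (W * W) div (2 * int q)"

text \<open>The last bound is strict because W^2 is odd. The first forces a polygon joining columns
  0 and \<open>far_col\<close> to cross x = m; the third yields the diameter estimate.\<close>

lemma far_col_bounds: "m \<le> far_col" "far_col < W" "W * W < 2 * int q * (far_col + 1)" "2 * int q * far_col < W * W"
proof -
  have q: "0 < 2 * int q" using p_less_q by simp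
  have "W * W = 2 * int q * far_col + (W * W) mod (2 * int q)" by (simp add: far_col_def)
  moreover have "0 \<le> (W * W) mod (2 * int q)" "(W * W) mod (2 * int q) < 2 * int q" using q by auto
  ultimately have *: "2 * int q * far_col \<le> W * W" "W * W < 2 * int q * (far_col + 1)"
    by (simp_all only: distrib_left mult_1_right)
  show "W * W < 2 * int q * (far_col + 1)" by (rule *)
  have "odd (W * W)" using odd_W by simp
  then have "W * W \<noteq> 2 * int q * far_col" by (metis dvd_mult2 dvd_triv_left)
  then show "2 * int q * far_col < W * W" using * by simp
  have "W < 2 * int q" using p_less_q by (simp add: W_def)
  then have "W * W < W * (2 * int q)" using W_pos by (simp only: mult_less_cancel_left_pos)
  then have "2 * int q * far_col < 2 * int q * W"
    using *(1) by (metis mult.commute order_le_less_trans)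
  then show "far_col < W" using q by (simp only: mult_less_cancel_left_pos)
  have "int q * (2 * m) \<le> W * W"
    by (rule mult_mono) (use m W_pos in \<open>auto simp: W_def\<close>)
  then have "2 * int q * m < 2 * int q * (far_col + 1)" using *(2) by simp
  then show "m \<le> far_col" using q by (simp only: mult_less_cancel_left_pos)
qed

lemma lit_m: "lit n m \<longleftrightarrow> W dvd n - m"
  by (rule lit_capacity_two[OF cap])

text \<open>By \<open>lit_m\<close> the light cuts are those with index divisible by W. Inside the
  block these are k = 0 for both slopes and k = W for slope -Q. The two cuts with k = 0 are the same
  point x = 0, a single light point.\<close>

lemma good_row:
  assumes i: "0 \<le> i" "i < W"
  shows "good_seg p q (Hseg i m) \<longleftrightarrow> i = 0 \<or> i = far_col"
proof -
  have pq: "0 < 2 * int p" "0 < 2 * int q" using p_pos p_less_q by auto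
  have bd: "0 \<le> 2 * int p * i" "2 * int p * (i + 1) \<le> W * (2 * int p)"
      "0 \<le> 2 * int q * i" "2 * int q * (i + 1) \<le> W * (2 * int q)"
    using i pq by (auto simp: mult.commute[of W])
  have P: "k = 0 \<and> i = 0" if k: "2 * int p * i \<le> W * k" "W * k \<le> 2 * int p * (i + 1)" "W dvd k" for k
  proof -
    have "W * 0 \<le> W * k" "W * k \<le> W * (2 * int p)" using k bd by linarith+
    then have "0 \<le> k" "k \<le> 2 * int p" using W_pos by (simp_all only: mult_le_cancel_left_pos)
    then have "k = 0" using W_dvd_small[OF k(3)] p_less_q by (auto simp: W_def)
    then show ?thesis using k i pq by (simp add: mult_le_0_iff)
  qed
  have Q: "k = 0 \<and> i = 0 \<or> k = W \<and> i = far_col"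
    if k: "2 * int q * i \<le> W * k" "W * k \<le> 2 * int q * (i + 1)" "W dvd k" for k
  proof -
    have "W * 0 \<le> W * k" "W * k \<le> W * (2 * int q)" using k bd by linarith+
    then have k0: "0 \<le> k" "k \<le> 2 * int q" using W_pos by (simp_all only: mult_le_cancel_left_pos)
    obtain l where l: "k = W * l" using k(3) by blast
    have "W * 0 \<le> W * l" "W * l < W * 2" using k0 p_pos unfolding l by (simp_all add: W_def)
    then have "0 \<le> l" "l < 2" using W_pos by (simp_all only: mult_le_cancel_left_pos mult_less_cancel_left_pos)
    then consider "k = 0" | "k = W" using l by fastforce
    then show ?thesis
    proof cases
      case 1
      then show ?thesis using k i pq by (simp add: mult_le_0_iff)
    next
      case 2
      have "2 * int q * i < 2 * int q * (far_col + 1)" "2 * int q * far_col < 2 * int q * (i + 1)"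
        using k far_col_bounds unfolding 2 by linarith+
      then have "i < far_col + 1" "far_col < i + 1" using pq by (simp_all only: mult_less_cancel_left_pos)
      then show ?thesis using 2 by simp
    qed
  qed
  have "good_seg p q (Hseg i m) \<longleftrightarrow> (i = 0) \<noteq> (i = far_col)"
  proof (rule good_seg_two_points)
    have "light_point p q (Hseg i m) (x, y) \<longleftrightarrow>
        y = of_int m \<and> (i = 0 \<and> x = P_cut 0 \<or> i = far_col \<and> x = Q_cut W)" (is "?l \<longleftrightarrow> ?r") for x y
    proof
      assume ?l
      then have "y = of_int m" "(\<exists>k. x = P_cut k \<and> k = 0 \<and> i = 0) \<or>
          (\<exists>k. x = Q_cut k \<and> (k = 0 \<and> i = 0 \<or> k = W \<and> i = far_col))"
        unfolding light_point_H_iff lit_m using P Q by auto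
      moreover have "Q_cut 0 = P_cut 0" by (simp add: P_cut_def Q_cut_def)
      ultimately show ?r by auto
    next
      assume ?r
      then show ?l unfolding light_point_H_iff lit_m
        using far_col_bounds pq by fastforce
    qed
    then show "{z. light_point p q (Hseg i m) z} = (if i = 0 then {(P_cut 0, of_int m)} else {}) \<union>
       (if i = far_col then {(Q_cut W, of_int m)} else {})" by auto
    \<comment> \<open>A midpoint would be counted twice. Here it would force q to divide W^2, but q
      > 1 is coprime to W.\<close>
    have "Q_cut W \<noteq> of_int i + 1/2"
    proof
      assume "Q_cut W = of_int i + 1/2"
      then have "of_int (W * W) = (of_int (int q * (2 * i + 1)) :: real)"
        using pq by (simp add: Q_cut_def field_simps)
      then have "W * W = int q * (2 * i + 1)" by (simp only: of_int_eq_iff)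
      then have "int q dvd W * W" by simp
      moreover have "coprime (int q) W"
        using coprime_pq
        by (simp add: W_def add.commute[of "int p"] coprime_iff_gcd_eq_1 gcd.commute)
      ultimately have "is_unit (int q)" by (metis coprime_dvd_mult_right_iff coprime_common_divisor dvd_refl)
      then show False using p_pos p_less_q by simp
    qed
    moreover have "P_cut 0 \<noteq> of_int i + 1/2" using i by (simp add: P_cut_def)
    moreover have "P_cut 0 \<noteq> Q_cut W" using W_pos pq by (simp add: P_cut_def Q_cut_def)
    ultimately show "(P_cut 0, real_of_int m) \<noteq> (Q_cut W, real_of_int m) \<and>
      (is_horiz (Hseg i m) \<longrightarrow> seg_mid (Hseg i m) \<noteq> (P_cut 0, real_of_int m) \<and>
        seg_mid (Hseg i m) \<noteq> (Q_cut W, real_of_int m)) \<or>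
      is_horiz (Hseg i m) \<and> (P_cut 0, real_of_int m) = seg_mid (Hseg i m) \<and>
      (Q_cut W, real_of_int m) = seg_mid (Hseg i m) \<and> (i = 0) = (i = far_col)"
      by (auto simp: seg_mid_H)
  qed
  then show ?thesis using far_col_bounds m by auto
qed

text \<open>A good edge has a light line, and by \<open>lit_m\<close> each of its two lines
  determines j mod W. The residues m - c and c - 1 - m add up to -1, so the two edges are mirror
  images.\<close>

lemma good_column:
  obtains a b where "\<And>j. 0 \<le> j \<Longrightarrow> j < W \<Longrightarrow> good_seg p q (Vseg m j) \<Longrightarrow> j = a \<or> j = b"
proof -
  obtain c where c: "W * (c - 1) < 2 * int p * m" "2 * int p * m \<le> W * c"
    by (rule ceiling_exists)
  have "j = (m - c) mod W \<or> j = (c - 1 - m) mod W"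
    if j: "0 \<le> j" "j < W" "good_seg p q (Vseg m j)" for j
  proof -
    have "lit (j + c) m \<or> lit (j + 2 * m - c + 1) m"
      using good_V[of m c j] j(3) m c by auto
    then have "W dvd j - (m - c) \<or> W dvd j - (c - 1 - m)"
      unfolding lit_m by (auto simp: algebra_simps)
    then have "j mod W = (m - c) mod W \<or> j mod W = (c - 1 - m) mod W"
      by (simp add: mod_eq_dvd_iff)
    then show ?thesis using j by simp
  qed
  then show thesis by (rule that)
qed

lemma long_symmetric_component:
  "\<exists>C\<in>components U. C \<subseteq> {0..of_int W} \<times> {0..of_int W} \<and>
    x_diameter C \<ge> of_int far_col \<and> refl_pt ` C = C"
proof -
  have "good_seg p q (Hseg 0 m)" using good_row[of 0] W_pos by simp
  then have "seg_mid (Hseg 0 m) \<in> U"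
    using half_segment_subset[of "Hseg 0 m" 0 m] by (auto simp: sq_edges_def)
  then obtain C where C: "C \<in> components U" and C0: "seg_mid (Hseg 0 m) \<in> C"
    by (metis componentsI connected_component_refl mem_Collect_eq)
  have box: "C \<subseteq> {0..of_int W} \<times> {0..of_int W}"
    by (rule component_in_block[OF C]) (use C0 m in \<open>auto simp: seg_mid_H\<close>)
  have "(\<Sum>i<p + q. crossing C (Hseg (int i) m)) =
      (\<Sum>i\<in>{0, nat far_col}. crossing C (Hseg (int i) m))"
    using far_col_bounds m good_row
    by (intro sum.mono_neutral_right) (auto simp: crossing_def W_def)
  also have "\<dots> = crossing C (Hseg 0 m) + crossing C (Hseg far_col m)"
    using far_col_bounds m by simp
  finally have "even (crossing C (Hseg 0 m) + crossing C (Hseg far_col m))"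
    using even_crossings_row[OF C, of "nat m"] m by simp
  then have C1: "seg_mid (Hseg far_col m) \<in> C"
    using C0 \<open>good_seg p q (Hseg 0 m)\<close> by (simp add: crossing_def split: if_splits)
  have con: "connected (fst ` C)"
    using in_components_connected[OF C]
    by (auto intro!: connected_continuous_image continuous_intros)
  have ends: "1/2 \<in> fst ` C" "of_int far_col + 1/2 \<in> fst ` C"
    using C0 C1 by (force simp: seg_mid_H)+
  have bounded: "bounded (fst ` C)"
    using box by (intro bounded_subset[OF bounded_closed_interval[of 0 "of_int W"]]) auto
  have "of_int far_col \<le> x_diameter C"
    using diameter_bounded_bound[OF bounded ends] far_col_bounds m
    by (simp add: x_diameter_def dist_real_def)
  moreover have "refl_pt ` C = C"
  proof -
    have "of_int m \<in> fst ` C"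
      by (rule connectedD_interval[OF con ends]) (use m far_col_bounds in linarith)+
    then obtain y where "(of_int m, y) \<in> C" by auto
    moreover from this obtain j where j: "good_seg p q (Vseg m j)" "(of_int m, y) = seg_mid (Vseg m j)"
      using in_components_subset[OF C] by (blast elim: plaid_union_on_vertical)
    ultimately have jC: "seg_mid (Vseg m j) \<in> C" by simp
    have j_range: "0 \<le> j \<and> j < W" if "seg_mid (Vseg m j) \<in> C" for j
    proof -
      have "0 \<le> real_of_int j + 1/2" "real_of_int j + 1/2 \<le> of_int W"
        using box that by (auto simp: seg_mid_V)
      then show ?thesis by linarith
    qed
    \<comment> \<open>Removing the known crossing j from an even sum leaves an odd one, so C crosses
      x = m at a second edge.\<close>
    have "(\<Sum>k<p + q. crossing C (Vseg m (int k))) = crossing C (Vseg m j) +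
        (\<Sum>k\<in>{..<p + q} - {nat j}. crossing C (Vseg m (int k)))"
      using j_range[OF jC] by (subst sum.remove[of _ "nat j"]) (auto simp: W_def)
    moreover have "crossing C (Vseg m j) = 1" using j jC by (simp add: crossing_def)
    moreover have "even (\<Sum>k<p + q. crossing C (Vseg m (int k)))"
      using even_crossings_column[OF C, of "nat m"] m by (simp add: W_def)
    ultimately have "(\<Sum>k\<in>{..<p + q} - {nat j}. crossing C (Vseg m (int k))) \<noteq> 0" by auto
    then obtain k where k: "k \<in> {..<p + q} - {nat j}" "crossing C (Vseg m (int k)) \<noteq> 0"
      by (meson sum.neutral)
    define j2 where "j2 = int k"
    have j2: "j2 \<noteq> j" "good_seg p q (Vseg m j2)" "seg_mid (Vseg m j2) \<in> C"
      using k by (auto simp: j2_def crossing_def split: if_splits)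
    define j3 where "j3 = W - 1 - j"
    have j3: "good_seg p q (Vseg m j3)" "seg_mid (Vseg m j3) = refl_pt (seg_mid (Vseg m j))"
      using good_seg_refl[of "Vseg m j"] seg_mid_refl_seg[of "Vseg m j"] j by (simp_all add: j3_def)
    have "0 \<le> j3" "j3 < W" using j_range[OF jC] by (auto simp: j3_def)
    \<comment> \<open>There are at most two good edges on x = m, and j and j2 are distinct ones; the
      mirror image j3 of j must be one of them, and both lie on C.\<close>
    then have "j3 = j \<or> j3 = j2"
      using good_column j j2 j3 j_range jC by metis
    then have "refl_pt (seg_mid (Vseg m j)) \<in> C" using j3 jC j2 by auto
    then show ?thesis using refl_component[OF C jC] by blast
  qed
  ultimately show ?thesis using C box by blast
qed

end

end

theorem theorem4p3:
  fixes p q :: nat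
  assumes "even_rational_param p q"
  shows "\<exists>C \<in> plaid_polygons p q.
           C \<subseteq> {0..omg p q} \<times> {0..omg p q} \<and>
           x_diameter C \<ge> (omg p q)\<^sup>2 / (2 * real q) - 1 \<and>
           (\<lambda>(x, y). (x, omg p q - y)) ` C = C"
proof -
  interpret even_param p q by standard (rule assms)
  obtain m where m: "1 \<le> m" "2 * m < W" "W dvd 2 * int p * m - 1 \<or> W dvd 2 * int p * m + 1"
    by (rule capacity_two_exists)
  obtain C where C: "C \<in> components (plaid_union p q)" "C \<subseteq> {0..of_int W} \<times> {0..of_int W}"
      "x_diameter C \<ge> of_int far_col" "refl_pt ` C = C"
    using long_symmetric_component[OF m] by blast
  have "of_int (W * W) < (of_int (2 * int q * (far_col + 1)) :: real)"
    using far_col_bounds(3)[OF m] by (simp only: of_int_less_iff)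
  then have "(of_int W)\<^sup>2 / (2 * real q) - 1 \<le> of_int far_col"
    using p_less_q by (simp add: field_simps power2_eq_square)
  moreover have "(\<lambda>(x, y). (x, of_int W - y)) = refl_pt"
    by (auto simp: refl_pt_def)
  ultimately show ?thesis
    unfolding plaid_polygons_def omg_eq using C by (intro bexI[of _ C]) auto
qed

end
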